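(* Let $n\ge 1$, let $M^n$ be a closed connected smooth $n$-dimensional manifold, let $\lambda\in\mathbb{R}$ be a constant, and let $x:M^n\to\mathbb{R}^{n+1}$ be a smooth immersion which is a $\lambda$-self-expander, i.e. $H-\frac12\langle x,\xi\rangle=\lambda$ on $M^n$. If the squared norm $S=|h|^2$ of the second fundamental form is constant on $M^n$, then $M^n$ is a round sphere centered at the origin.
   Context: Let $x:M^n\to\mathbb{R}^{n+1}$ be an immersed hypersurface with the induced metric $I=\langle dx,dx\rangle$, and let $\xi$ be its smooth global unit normal field, called the inward unit normal (for a round sphere centered at the origin it points towards the center). For a local orthonormal frame $e_1,\dots,e_n$ with dual coframe $\omega_1,\dots,\omega_n$, the second fundamental form $h=\sum_{i,j}h_{ij}\,\omega_i\otimes\omega_j$ is given by $d\xi=-\sum_{i,j}h_{ij}\omega_j e_i$. The mean curvature is the trace $H=\sum_i h_{ii}$ (not divided by $n$; so the round sphere of radius $r$ has $H=n/r$), and $S=|h|^2=\sum_{i,j}h_{ij}^2$. "Closed" means compact without boundary. The immersion $x$ is a $\lambda$-self-expander if $H-\frac12\langle x,\xi\rangle=\lambda$ on $M^n$ for the constant $\lambda$. "$M^n$ is a round sphere centered at the origin" means that $x(M^n)=\{y\in\mathbb{R}^{n+1}:|y|=r\}$ for some $r>0$. *)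

theory Defs
  imports "HOL-Analysis.Analysis"
begin

section \<open>Smooth maps on open subsets of normed spaces\<close>

text \<open>\<open>Ck_on\<close> and \<open>smooth_on\<close> are meant for an open set \<open>S\<close> of a finite-dimensional space.\<close>

fun Ck_on :: "nat \<Rightarrow> ('a::real_normed_vector \<Rightarrow> 'b::real_normed_vector) \<Rightarrow> 'a set \<Rightarrow> bool" where
  "Ck_on 0 f S \<longleftrightarrow> continuous_on S f"
| "Ck_on (Suc k) f S \<longleftrightarrow>
     f differentiable_on S \<and> (\<forall>v. Ck_on k (\<lambda>y. frechet_derivative f (at y) v) S)"

definition smooth_on :: "('a::real_normed_vector \<Rightarrow> 'b::real_normed_vector) \<Rightarrow> 'a set \<Rightarrow> bool" where
  "smooth_on f S \<longleftrightarrow> (\<forall>k. Ck_on k f S)"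

section \<open>Smooth manifolds without boundary\<close>

text \<open>A chart is a pair of its domain \<open>U\<close> and the coordinate map, of which only the values on
  \<open>U\<close> matter. The dimension of the manifold is \<open>CARD('n) \<ge> 1\<close>.\<close>

type_synonym ('a, 'n) chart = "'a set \<times> ('a \<Rightarrow> real ^ 'n)"

definition is_chart :: "'a topology \<Rightarrow> ('a, 'n::finite) chart \<Rightarrow> bool" where
  "is_chart M c \<longleftrightarrow> (case c of (U, \<phi>) \<Rightarrow>
     openin M U \<and> open (\<phi> ` U) \<and>
     homeomorphic_map (subtopology M U) (top_of_set (\<phi> ` U)) \<phi>)"

text \<open>The expression of \<open>f\<close> in a chart, \<open>f \<circ> \<phi>\<^sup>-\<^sup>1\<close>; it is relevant on \<open>\<phi> ` U\<close> only.\<close>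

definition local_rep :: "('a, 'n::finite) chart \<Rightarrow> ('a \<Rightarrow> 'b) \<Rightarrow> real ^ 'n \<Rightarrow> 'b" where
  "local_rep c f = f \<circ> inv_into (fst c) (snd c)"

definition smooth_atlas :: "'a topology \<Rightarrow> ('a, 'n::finite) chart set \<Rightarrow> bool" where
  "smooth_atlas M A \<longleftrightarrow>
     (\<forall>c\<in>A. is_chart M c) \<and> (\<Union>c\<in>A. fst c) = topspace M \<and>
     (\<forall>c\<in>A. \<forall>d\<in>A. smooth_on (local_rep c (snd d)) (snd c ` (fst c \<inter> fst d)))"

text \<open>The atlas need not be maximal.\<close>

definition smooth_manifold :: "'a topology \<Rightarrow> ('a, 'n::finite) chart set \<Rightarrow> bool" where
  "smooth_manifold M A \<longleftrightarrow> Hausdorff_space M \<and> second_countable M \<and> smooth_atlas M A"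

text \<open>Connected manifolds are nonempty; \<^const>\<open>connected_space\<close> alone admits the empty space.\<close>

definition closed_connected_manifold :: "'a topology \<Rightarrow> ('a, 'n::finite) chart set \<Rightarrow> bool" where
  "closed_connected_manifold M A \<longleftrightarrow>
     smooth_manifold M A \<and> compact_space M \<and> connected_space M \<and> topspace M \<noteq> {}"

definition smooth_map ::
  "('a, 'n::finite) chart set \<Rightarrow> ('a \<Rightarrow> 'b::real_normed_vector) \<Rightarrow> bool" where
  "smooth_map A f \<longleftrightarrow> (\<forall>c\<in>A. smooth_on (local_rep c f) (snd c ` fst c))"

text \<open>\<open>differential c f p\<close> is \<open>df\<close> at \<open>p\<close>, where a tangent vector at \<open>p\<close> is given by its
  components in the chart \<open>c\<close>.\<close>

definition differential ::
  "('a, 'n::finite) chart \<Rightarrow> ('a \<Rightarrow> 'b::real_normed_vector) \<Rightarrow> 'a \<Rightarrow> real ^ 'n \<Rightarrow> 'b" where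
  "differential c f p = frechet_derivative (local_rep c f) (at (snd c p))"

definition smooth_immersion ::
  "('a, 'n::finite) chart set \<Rightarrow> ('a \<Rightarrow> 'b::real_normed_vector) \<Rightarrow> bool" where
  "smooth_immersion A x \<longleftrightarrow>
     smooth_map A x \<and> (\<forall>c\<in>A. \<forall>p\<in>fst c. inj (differential c x p))"

section \<open>Geometry of an immersed hypersurface\<close>

definition unit_normal_field ::
  "('a, 'n::finite) chart set \<Rightarrow> ('a \<Rightarrow> 'b::euclidean_space) \<Rightarrow> ('a \<Rightarrow> 'b) \<Rightarrow> bool" where
  "unit_normal_field A x \<xi> \<longleftrightarrow> smooth_map A \<xi> \<and>
     (\<forall>c\<in>A. \<forall>p\<in>fst c. norm (\<xi> p) = 1 \<and> (\<forall>v. differential c x p v \<bullet> \<xi> p = 0))"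

definition first_fundamental_form ::
  "('a \<Rightarrow> 'b::euclidean_space) \<Rightarrow> ('a, 'n::finite) chart \<Rightarrow> 'a \<Rightarrow> real ^ 'n \<Rightarrow> real ^ 'n \<Rightarrow> real" where
  "first_fundamental_form x c p v w = differential c x p v \<bullet> differential c x p w"

text \<open>With \<open>d\<xi> = - (\<Sum>i j. h\<^sub>i\<^sub>j \<omega>\<^sub>j e\<^sub>i)\<close>, where \<open>e\<^sub>i\<close> is identified with \<open>dx(e\<^sub>i)\<close>, one has
  \<open>h\<^sub>i\<^sub>j = h(e\<^sub>i, e\<^sub>j) = - \<langle>d\<xi>(e\<^sub>j), dx(e\<^sub>i)\<rangle>\<close>; for the round sphere of radius \<open>r\<close> and
  \<open>\<xi> = - x / r\<close> this is \<open>h = I / r\<close>.\<close>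

definition second_fundamental_form ::
  "('a \<Rightarrow> 'b::euclidean_space) \<Rightarrow> ('a \<Rightarrow> 'b) \<Rightarrow> ('a, 'n::finite) chart \<Rightarrow> 'a
     \<Rightarrow> real ^ 'n \<Rightarrow> real ^ 'n \<Rightarrow> real" where
  "second_fundamental_form x \<xi> c p v w = - (differential c \<xi> p w \<bullet> differential c x p v)"

definition orthonormal_frame ::
  "('a \<Rightarrow> 'b::euclidean_space) \<Rightarrow> ('a, 'n::finite) chart \<Rightarrow> 'a \<Rightarrow> ('n \<Rightarrow> real ^ 'n) \<Rightarrow> bool" where
  "orthonormal_frame x c p e \<longleftrightarrow>
     (\<forall>i j. first_fundamental_form x c p (e i) (e j) = (if i = j then 1 else 0))"

text \<open>\<open>H = (\<Sum>i. h\<^sub>i\<^sub>i)\<close> and \<open>S = (\<Sum>i j. h\<^sub>i\<^sub>j\<^sup>2)\<close> are the common values over all charts at \<open>p\<close>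
  and all orthonormal frames; that they are well defined is proved below.\<close>

definition mean_curvature ::
  "('a, 'n::finite) chart set \<Rightarrow> ('a \<Rightarrow> 'b::euclidean_space) \<Rightarrow> ('a \<Rightarrow> 'b) \<Rightarrow> 'a \<Rightarrow> real" where
  "mean_curvature A x \<xi> p = (THE H. \<forall>c\<in>A. \<forall>e. p \<in> fst c \<and> orthonormal_frame x c p e \<longrightarrow>
     H = (\<Sum>i\<in>UNIV. second_fundamental_form x \<xi> c p (e i) (e i)))"

definition sff_norm_sq ::
  "('a, 'n::finite) chart set \<Rightarrow> ('a \<Rightarrow> 'b::euclidean_space) \<Rightarrow> ('a \<Rightarrow> 'b) \<Rightarrow> 'a \<Rightarrow> real" where
  "sff_norm_sq A x \<xi> p = (THE S. \<forall>c\<in>A. \<forall>e. p \<in> fst c \<and> orthonormal_frame x c p e \<longrightarrow>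
     S = (\<Sum>i\<in>UNIV. \<Sum>j\<in>UNIV. (second_fundamental_form x \<xi> c p (e i) (e j))\<^sup>2))"

definition self_expander ::
  "real \<Rightarrow> 'a topology \<Rightarrow> ('a, 'n::finite) chart set \<Rightarrow> ('a \<Rightarrow> 'b::euclidean_space) \<Rightarrow> ('a \<Rightarrow> 'b)
     \<Rightarrow> bool" where
  "self_expander lam M A x \<xi> \<longleftrightarrow>
     (\<forall>p\<in>topspace M. mean_curvature A x \<xi> p - 1 / 2 * (x p \<bullet> \<xi> p) = lam)"

section \<open>Well-definedness of \<open>H\<close> and \<open>S\<close>\<close>

lemma chart_inj:
  assumes "is_chart M c" shows "inj_on (snd c) (fst c)"
proof -
  have "topspace (subtopology M (fst c)) = fst c"
    and "homeomorphic_map (subtopology M (fst c)) (top_of_set (snd c ` fst c)) (snd c)"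
    using assms openin_subset by (auto simp: is_chart_def case_prod_beta)
  then show ?thesis using homeomorphic_imp_injective_map by metis
qed

lemma chart_open_image:
  assumes "is_chart M c" "openin M W"
  shows "open (snd c ` (fst c \<inter> W))"
proof -
  have U: "openin M (fst c)" and o: "open (snd c ` fst c)"
    and h: "homeomorphic_map (subtopology M (fst c)) (top_of_set (snd c ` fst c)) (snd c)"
    using assms(1) by (auto simp: is_chart_def case_prod_beta)
  have "openin (subtopology M (fst c)) (fst c \<inter> W)"
    using assms(2) by (auto simp: openin_subtopology)
  then have "openin (top_of_set (snd c ` fst c)) (snd c ` (fst c \<inter> W))"
    using h homeomorphic_imp_open_map open_map_def by blast
  then show ?thesis using o openin_open_trans by blast
qed

lemma smooth_on_differentiable:
  assumes "smooth_on f S" "open S" "y \<in> S"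
  shows "f differentiable (at y)"
proof -
  have "Ck_on (Suc 0) f S" using assms(1) by (simp only: smooth_on_def)
  then have "f differentiable_on S" by simp
  then show ?thesis using assms(2,3)
    by (simp add: differentiable_on_eq_differentiable_at)
qed

lemma smooth_map_differentiable:
  assumes "smooth_atlas M A" "smooth_map A f" "c \<in> A" "p \<in> fst c"
  shows "local_rep c f differentiable (at (snd c p))"
proof (rule smooth_on_differentiable)
  show "smooth_on (local_rep c f) (snd c ` fst c)"
    using assms by (auto simp: smooth_map_def)
  show "open (snd c ` fst c)"
    using assms by (auto simp: smooth_atlas_def is_chart_def case_prod_beta)
qed (use assms in auto)

lemma linear_differential:
  assumes "smooth_atlas M A" "smooth_map A f" "c \<in> A" "p \<in> fst c"
  shows "linear (differential c f p)"
  unfolding differential_def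
  using smooth_map_differentiable[OF assms] linear_frechet_derivative by blast

lemma differential_change_chart:
  assumes A: "smooth_atlas M A" and f: "smooth_map A f"
    and c: "c \<in> A" "p \<in> fst c" and d: "d \<in> A" "p \<in> fst d"
  shows "differential c f p v = differential d f p (differential c (snd d) p v)"
proof -
  define W where "W = snd c ` (fst c \<inter> fst d)"
  have cc: "is_chart M c" and dd: "is_chart M d" using A c d by (auto simp: smooth_atlas_def)
  have inj: "inj_on (snd c) (fst c)" "inj_on (snd d) (fst d)"
    using chart_inj cc dd by blast+
  have "openin M (fst d)" using dd by (auto simp: is_chart_def case_prod_beta)
  then have oW: "open W" unfolding W_def using chart_open_image[OF cc] by blast
  have pW: "snd c p \<in> W" using c d by (auto simp: W_def)
  have "smooth_on (local_rep c (snd d)) W"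
    using A c d by (auto simp: smooth_atlas_def W_def)
  then have T: "local_rep c (snd d) differentiable (at (snd c p))"
    using smooth_on_differentiable oW pW by blast
  have Tp: "local_rep c (snd d) (snd c p) = snd d p"
    using inj c by (simp add: local_rep_def)
  have F: "local_rep d f differentiable (at (snd d p))"
    using smooth_map_differentiable[OF A f d] .
  have 1: "((local_rep d f \<circ> local_rep c (snd d)) has_derivative
      (differential d f p \<circ> differential c (snd d) p)) (at (snd c p))"
    unfolding differential_def
    by (rule diff_chain_at) (use T F Tp frechet_derivative_works in auto)
  have eq: "(local_rep d f \<circ> local_rep c (snd d)) y = local_rep c f y" if "y \<in> W" for y
    using that inj by (auto simp: W_def local_rep_def)
  have "(local_rep c f has_derivative
      (differential d f p \<circ> differential c (snd d) p)) (at (snd c p))"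
    by (rule has_derivative_transform_within_open[OF 1 oW pW]) (use eq in auto)
  then have "frechet_derivative (local_rep c f) (at (snd c p))
      = differential d f p \<circ> differential c (snd d) p"
    using frechet_derivative_at by metis
  then show ?thesis by (simp add: differential_def)
qed

lemma orthonormal_frame_exists:
  fixes x :: "'a \<Rightarrow> 'b::euclidean_space" and c :: "('a, 'n::finite) chart"
  assumes "linear (differential c x p)" "inj (differential c x p)"
  shows "\<exists>e. orthonormal_frame x c p e"
proof -
  let ?D = "differential c x p"
  have sub: "subspace (range ?D)"
    using assms(1) linear_subspace_image subspace_UNIV by blast
  have dim: "dim (range ?D) = CARD('n)"
    using dim_image_eq[OF assms(1), of UNIV] assms(2) by (simp add: dim_UNIV)
  obtain B where B: "B \<subseteq> range ?D" "pairwise orthogonal B" "\<And>b. b \<in> B \<Longrightarrow> norm b = 1"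
    "independent B" "card B = dim (range ?D)"
    using orthonormal_basis_subspace[OF sub] by metis
  have "finite B" using B(4) independent_imp_finite by blast
  then obtain \<beta> :: "'n \<Rightarrow> 'b" where \<beta>: "bij_betw \<beta> UNIV B"
    using B(5) dim finite_same_card_bij[of "UNIV::'n set" B] by auto
  then have \<beta>B: "\<beta> i \<in> B" for i by (auto simp: bij_betw_def)
  then have "\<beta> i \<in> range ?D" for i using B(1) by blast
  then have "\<forall>i. \<exists>v. ?D v = \<beta> i" by (metis rangeE)
  then obtain e where e: "\<And>i. ?D (e i) = \<beta> i" by metis
  have "\<beta> i \<bullet> \<beta> j = (if i = j then 1 else 0)" for i j
  proof (cases "i = j")
    case True
    have "norm (\<beta> j) = 1" using \<beta>B B(3) by blast
    then show ?thesis using True by (simp add: norm_eq_1)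
  next
    case False
    then have "\<beta> i \<noteq> \<beta> j" "\<beta> i \<in> B" "\<beta> j \<in> B"
      using \<beta> \<beta>B by (auto simp: bij_betw_def inj_on_def)
    then show ?thesis using False B(2) by (auto simp: pairwise_def orthogonal_def)
  qed
  then have "orthonormal_frame x c p e"
    unfolding orthonormal_frame_def first_fundamental_form_def e by blast
  then show ?thesis by blast
qed

lemma orthonormal_frame_change:
  fixes x :: "'a \<Rightarrow> 'b::euclidean_space" and c :: "('a, 'n::finite) chart"
  assumes lin: "linear (differential c x p)"
    and e: "orthonormal_frame x c p e" and e': "orthonormal_frame x c p e'"
  obtains P :: "'n \<Rightarrow> 'n \<Rightarrow> real"
  where "\<And>i. e' i = (\<Sum>j\<in>UNIV. P i j *\<^sub>R e j)"
    and "\<And>j k. (\<Sum>i\<in>UNIV. P i j * P i k) = (if j = k then 1 else 0)"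
proof -
  let ?D = "differential c x p"
  have E: "?D (e i) \<bullet> ?D (e j) = (if i = j then 1 else 0)"
    and E': "?D (e' i) \<bullet> ?D (e' j) = (if i = j then 1 else 0)" for i j
    using e e' by (auto simp: orthonormal_frame_def first_fundamental_form_def)
  define P where "P i j = ?D (e' i) \<bullet> ?D (e j)" for i j
  have D_sum: "?D (\<Sum>j\<in>UNIV. a j *\<^sub>R e j) = (\<Sum>j\<in>UNIV. a j *\<^sub>R ?D (e j))" for a
    using lin by (simp add: linear_sum linear_cmul)
  have D_inner: "?D (\<Sum>j\<in>UNIV. a j *\<^sub>R e j) \<bullet> ?D (e k) = a k" for a k
    unfolding D_sum by (simp add: inner_sum_left E if_distrib cong: if_cong)
  define L where "L = (\<lambda>a::real^'n. \<Sum>j\<in>UNIV. a $ j *\<^sub>R e j)"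
  have linL: "linear L"
    unfolding L_def
    by (rule linearI) (simp_all add: algebra_simps sum.distrib scaleR_right.sum)
  have "inj L"
  proof (rule injI)
    fix a b assume "L a = L b"
    then have "a $ k = b $ k" for k
      using D_inner[of "\<lambda>j. a $ j" k] D_inner[of "\<lambda>j. b $ j" k] by (simp add: L_def)
    then show "a = b" by (simp add: vec_eq_iff)
  qed
  then have "surj L" using linL linear_injective_imp_surjective by blast
  have exp: "e' i = (\<Sum>j\<in>UNIV. P i j *\<^sub>R e j)" for i
  proof -
    obtain a where a: "e' i = (\<Sum>j\<in>UNIV. a $ j *\<^sub>R e j)"
      using \<open>surj L\<close> unfolding L_def surj_def by blast
    have "P i k = a $ k" for k
      unfolding P_def a by (rule D_inner)
    then show ?thesis using a by simp
  qed
  have PP: "(\<Sum>k\<in>UNIV. P i k * P j k) = (if i = j then 1 else 0)" for i j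
  proof -
    have "(if i = j then 1 else 0) = ?D (\<Sum>k\<in>UNIV. P i k *\<^sub>R e k) \<bullet> ?D (e' j)"
      using E'[of i j] exp[of i] by simp
    also have "\<dots> = (\<Sum>k\<in>UNIV. P i k * P j k)"
      unfolding D_sum inner_sum_left inner_scaleR_left
      by (rule sum.cong) (simp_all add: P_def inner_commute)
    finally show ?thesis by simp
  qed
  define Q :: "real^'n^'n" where "Q = (\<chi> i j. P i j)"
  have "Q ** transpose Q = mat 1"
    by (auto simp: Q_def matrix_matrix_mult_def transpose_def mat_def vec_eq_iff PP)
  then have "transpose Q ** Q = mat 1"
    using matrix_left_right_inverse by blast
  then have "(\<Sum>i\<in>UNIV. P i j * P i k) = (if j = k then 1 else 0)" for j k
    by (simp add: Q_def matrix_matrix_mult_def transpose_def mat_def vec_eq_iff)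
  with exp show ?thesis using that by blast
qed

lemma frame_sums_same_chart:
  fixes h :: "real^'n::finite \<Rightarrow> real^'n \<Rightarrow> real" and P :: "'n \<Rightarrow> 'n \<Rightarrow> real"
  assumes l1: "\<And>w. linear (\<lambda>v. h v w)" and l2: "\<And>v. linear (h v)"
    and exp: "\<And>i. e' i = (\<Sum>j\<in>UNIV. P i j *\<^sub>R e j)"
    and P: "\<And>j k. (\<Sum>i\<in>UNIV. P i j * P i k) = (if j = k then 1 else 0::real)"
  shows "(\<Sum>i\<in>UNIV. h (e' i) (e' i)) = (\<Sum>i\<in>UNIV. h (e i) (e i))"
    and "(\<Sum>i\<in>UNIV. \<Sum>j\<in>UNIV. (h (e' i) (e' j))\<^sup>2) = (\<Sum>i\<in>UNIV. \<Sum>j\<in>UNIV. (h (e i) (e j))\<^sup>2)"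
proof -
  have h1: "h (e' i) w = (\<Sum>j\<in>UNIV. P i j * h (e j) w)" for i w
    unfolding exp by (simp add: linear_sum[OF l1] linear_cmul[OF l1])
  have h2: "h v (e' i) = (\<Sum>j\<in>UNIV. P i j * h v (e j))" for i v
    unfolding exp by (simp add: linear_sum[OF l2] linear_cmul[OF l2])
  have key: "(\<Sum>i\<in>UNIV. (\<Sum>j\<in>UNIV. P i j * a j) * (\<Sum>k\<in>UNIV. P i k * b k)) = (\<Sum>j\<in>UNIV. a j * b j)"
    for a b :: "'n \<Rightarrow> real"
  proof -
    have "(\<Sum>i\<in>UNIV. (\<Sum>j\<in>UNIV. P i j * a j) * (\<Sum>k\<in>UNIV. P i k * b k))
        = (\<Sum>i\<in>UNIV. \<Sum>j\<in>UNIV. \<Sum>k\<in>UNIV. a j * b k * (P i j * P i k))"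
      by (simp add: sum_product mult_ac)
    also have "\<dots> = (\<Sum>j\<in>UNIV. \<Sum>i\<in>UNIV. \<Sum>k\<in>UNIV. a j * b k * (P i j * P i k))"
      by (rule sum.swap)
    also have "\<dots> = (\<Sum>j\<in>UNIV. \<Sum>k\<in>UNIV. \<Sum>i\<in>UNIV. a j * b k * (P i j * P i k))"
      by (rule sum.cong[OF refl]) (rule sum.swap)
    also have "\<dots> = (\<Sum>j\<in>UNIV. \<Sum>k\<in>UNIV. a j * b k * (if j = k then 1 else 0))"
      by (simp only: P flip: sum_distrib_left)
    also have "\<dots> = (\<Sum>j\<in>UNIV. a j * b j)" by (simp add: if_distrib cong: if_cong)
    finally show ?thesis .
  qed
  have tr: "(\<Sum>i\<in>UNIV. g (e' i) (e' i)) = (\<Sum>i\<in>UNIV. g (e i) (e i))"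
    if g: "\<And>i w. g (e' i) w = (\<Sum>j\<in>UNIV. P i j * g (e j) w)"
      "\<And>i v. g v (e' i) = (\<Sum>j\<in>UNIV. P i j * g v (e j))" for g :: "real^'n \<Rightarrow> real^'n \<Rightarrow> real"
  proof -
    have "(\<Sum>i\<in>UNIV. g (e' i) (e' i)) = (\<Sum>i\<in>UNIV. \<Sum>j\<in>UNIV. \<Sum>k\<in>UNIV. g (e j) (e k) * (P i j * P i k))"
      by (subst g(1), subst g(2)) (simp add: sum_distrib_left mult_ac)
    also have "\<dots> = (\<Sum>j\<in>UNIV. \<Sum>i\<in>UNIV. \<Sum>k\<in>UNIV. g (e j) (e k) * (P i j * P i k))"
      by (rule sum.swap)
    also have "\<dots> = (\<Sum>j\<in>UNIV. \<Sum>k\<in>UNIV. \<Sum>i\<in>UNIV. g (e j) (e k) * (P i j * P i k))"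
      by (rule sum.cong[OF refl]) (rule sum.swap)
    also have "\<dots> = (\<Sum>j\<in>UNIV. \<Sum>k\<in>UNIV. g (e j) (e k) * (if j = k then 1 else 0))"
      by (simp only: P flip: sum_distrib_left)
    also have "\<dots> = (\<Sum>j\<in>UNIV. g (e j) (e j))" by (simp add: if_distrib cong: if_cong)
    finally show ?thesis .
  qed
  show "(\<Sum>i\<in>UNIV. h (e' i) (e' i)) = (\<Sum>i\<in>UNIV. h (e i) (e i))"
    by (rule tr[OF h1 h2])
  have "(\<Sum>i\<in>UNIV. \<Sum>j\<in>UNIV. (h (e' i) (e' j))\<^sup>2) = (\<Sum>i\<in>UNIV. \<Sum>j\<in>UNIV. (h (e' i) (e j))\<^sup>2)"
    by (rule sum.cong[OF refl]) (simp add: h2 power2_eq_square key)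
  also have "\<dots> = (\<Sum>j\<in>UNIV. \<Sum>i\<in>UNIV. (h (e' i) (e j))\<^sup>2)" by (rule sum.swap)
  also have "\<dots> = (\<Sum>j\<in>UNIV. \<Sum>i\<in>UNIV. (h (e i) (e j))\<^sup>2)"
    by (rule sum.cong[OF refl]) (simp add: h1 power2_eq_square key)
  also have "\<dots> = (\<Sum>i\<in>UNIV. \<Sum>j\<in>UNIV. (h (e i) (e j))\<^sup>2)" by (rule sum.swap)
  finally show "(\<Sum>i\<in>UNIV. \<Sum>j\<in>UNIV. (h (e' i) (e' j))\<^sup>2)
      = (\<Sum>i\<in>UNIV. \<Sum>j\<in>UNIV. (h (e i) (e j))\<^sup>2)" .
qed

lemma frame_sums_independent:
  fixes x \<xi> :: "'a \<Rightarrow> 'b::euclidean_space" and A :: "('a, 'n::finite) chart set"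
  assumes A: "smooth_atlas M A" and x: "smooth_map A x" and \<xi>: "smooth_map A \<xi>"
    and c: "c \<in> A" "p \<in> fst c" "orthonormal_frame x c p e"
    and d: "d \<in> A" "p \<in> fst d" "orthonormal_frame x d p e'"
  shows "(\<Sum>i\<in>UNIV. second_fundamental_form x \<xi> c p (e i) (e i))
       = (\<Sum>i\<in>UNIV. second_fundamental_form x \<xi> d p (e' i) (e' i))" (is ?H)
    and "(\<Sum>i\<in>UNIV. \<Sum>j\<in>UNIV. (second_fundamental_form x \<xi> c p (e i) (e j))\<^sup>2)
       = (\<Sum>i\<in>UNIV. \<Sum>j\<in>UNIV. (second_fundamental_form x \<xi> d p (e' i) (e' j))\<^sup>2)" (is ?S)
proof -
  let ?T = "differential c (snd d) p"
  note ch = differential_change_chart[OF A _ c(1,2) d(1,2)]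
  have s: "second_fundamental_form x \<xi> c p v w = second_fundamental_form x \<xi> d p (?T v) (?T w)" for v w
    unfolding second_fundamental_form_def ch[OF x] ch[OF \<xi>] ..
  have f: "orthonormal_frame x d p (\<lambda>i. ?T (e i))"
    using c(3) unfolding orthonormal_frame_def first_fundamental_form_def ch[OF x] .
  have lx: "linear (differential d x p)" and l\<xi>: "linear (differential d \<xi> p)"
    using linear_differential[OF A _ d(1,2)] x \<xi> by auto
  obtain P :: "'n \<Rightarrow> 'n \<Rightarrow> real" where P: "\<And>i. ?T (e i) = (\<Sum>j\<in>UNIV. P i j *\<^sub>R e' j)"
    "\<And>j k. (\<Sum>i\<in>UNIV. P i j * P i k) = (if j = k then 1 else 0)"
    by (rule orthonormal_frame_change[OF lx d(3) f]) (rule that)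
  have l1: "linear (\<lambda>v. second_fundamental_form x \<xi> d p v w)" for w
    unfolding second_fundamental_form_def
    by (rule linearI) (simp_all add: linear_add[OF lx] linear_cmul[OF lx] inner_simps)
  have l2: "linear (second_fundamental_form x \<xi> d p v)" for v
    unfolding second_fundamental_form_def
    by (rule linearI) (simp_all add: linear_add[OF l\<xi>] linear_cmul[OF l\<xi>] inner_simps)
  show ?H unfolding s by (rule frame_sums_same_chart(1)[OF l1 l2 P])
  show ?S unfolding s by (rule frame_sums_same_chart(2)[OF l1 l2 P])
qed

lemma mean_curvature_eq:
  assumes A: "smooth_atlas M A" and x: "smooth_immersion A x" and \<xi>: "unit_normal_field A x \<xi>"
    and c: "c \<in> A" "p \<in> fst c" "orthonormal_frame x c p e"
  shows "mean_curvature A x \<xi> p = (\<Sum>i\<in>UNIV. second_fundamental_form x \<xi> c p (e i) (e i))"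
  unfolding mean_curvature_def
proof (rule the_equality)
  have x': "smooth_map A x" and \<xi>': "smooth_map A \<xi>"
    using x \<xi> by (auto simp: smooth_immersion_def unit_normal_field_def)
  show "\<forall>d\<in>A. \<forall>e'. p \<in> fst d \<and> orthonormal_frame x d p e' \<longrightarrow>
      (\<Sum>i\<in>UNIV. second_fundamental_form x \<xi> c p (e i) (e i))
    = (\<Sum>i\<in>UNIV. second_fundamental_form x \<xi> d p (e' i) (e' i))"
    using frame_sums_independent(1)[OF A x' \<xi>' c] by blast
qed (use c in blast)

lemma sff_norm_sq_eq:
  assumes A: "smooth_atlas M A" and x: "smooth_immersion A x" and \<xi>: "unit_normal_field A x \<xi>"
    and c: "c \<in> A" "p \<in> fst c" "orthonormal_frame x c p e"
  shows "sff_norm_sq A x \<xi> p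
    = (\<Sum>i\<in>UNIV. \<Sum>j\<in>UNIV. (second_fundamental_form x \<xi> c p (e i) (e j))\<^sup>2)"
  unfolding sff_norm_sq_def
proof (rule the_equality)
  have x': "smooth_map A x" and \<xi>': "smooth_map A \<xi>"
    using x \<xi> by (auto simp: smooth_immersion_def unit_normal_field_def)
  show "\<forall>d\<in>A. \<forall>e'. p \<in> fst d \<and> orthonormal_frame x d p e' \<longrightarrow>
      (\<Sum>i\<in>UNIV. \<Sum>j\<in>UNIV. (second_fundamental_form x \<xi> c p (e i) (e j))\<^sup>2)
    = (\<Sum>i\<in>UNIV. \<Sum>j\<in>UNIV. (second_fundamental_form x \<xi> d p (e' i) (e' j))\<^sup>2)"
    using frame_sums_independent(2)[OF A x' \<xi>' c] by blast
qed (use c in blast)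

end

theory Submission
  imports Defs
begin

text \<open>Let \<open>p\<close> be a point of \<open>M\<close> farthest from the origin. There \<open>x = u\<^sub>0 \<xi>\<close> for a number \<open>u\<^sub>0 \<noteq> 0\<close>,
  and the second derivative test for \<open>|x|\<^sup>2\<close> says that \<open>K = - u\<^sub>0 h\<close> satisfies \<open>K \<ge> I\<close>. Writing
  \<open>M\<close> near \<open>p\<close> as a graph over its tangent hyperplane, differentiating \<open>H - \<langle>x, \<xi>\<rangle> / 2 = \<lambda>\<close>
  and the constant \<open>S\<close> twice at \<open>p\<close> gives the Simons identity
  \<open>|\<nabla>h|\<^sup>2 = S\<^sup>2 + S / 2 - \<lambda> tr h\<^sup>3\<close>. With \<open>k\<^sub>i = tr K\<^sup>i\<close> its nonnegativity reads
  \<open>(k\<^sub>1 k\<^sub>3 - k\<^sub>2\<^sup>2) + u\<^sub>0\<^sup>2 / 2 (k\<^sub>3 - k\<^sub>2) \<le> 0\<close>, where both terms are nonnegative because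
  \<open>K \<ge> I\<close>; hence \<open>K = I\<close> at \<open>p\<close>, so that \<open>S = n / u\<^sub>0\<^sup>2\<close> and \<open>H(p) = - n / u\<^sub>0\<close>. Everywhere
  else \<open>\<langle>x, \<xi>\<rangle>\<close> is bounded by \<open>|u\<^sub>0|\<close>, so that \<open>- u\<^sub>0 H \<ge> n\<close> by the self-expander equation,
  while \<open>H\<^sup>2 \<le> n S\<close>; therefore \<open>\<langle>x, \<xi>\<rangle> = u\<^sub>0\<close> and \<open>|x| = |u\<^sub>0|\<close>. The image is compact and open
  in the sphere of radius \<open>|u\<^sub>0|\<close>, hence all of it.\<close>

section \<open>Calculus of smooth maps\<close>

text \<open>The point is abstracted, so a derivative along a fixed direction is again a map, and
  iterates such as \<open>ddir w (ddir v f)\<close> are higher derivatives, in step with the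
  recursion of \<open>Ck_on\<close>.\<close>

definition ddir :: "'a::real_normed_vector \<Rightarrow> ('a \<Rightarrow> 'b::real_normed_vector) \<Rightarrow> 'a \<Rightarrow> 'b" where
  "ddir v f = (\<lambda>y. frechet_derivative f (at y) v)"

lemma Ck_on_Suc:
  "Ck_on (Suc k) f S \<longleftrightarrow> f differentiable_on S \<and> (\<forall>v. Ck_on k (ddir v f) S)"
  by (simp add: ddir_def)

lemma Ck_on_ddir: "Ck_on (Suc k) f S \<Longrightarrow> Ck_on k (ddir v f) S"
  using Ck_on_Suc by blast

lemma ddir_eqI: "(f has_derivative f') (at y) \<Longrightarrow> ddir v f y = f' v"
  unfolding ddir_def using frechet_derivative_at by metis

text \<open>Both sides choose from the same set of derivatives at \<open>y\<close>, so the equality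
  also covers points without differentiability.\<close>

lemma ddir_cong:
  assumes "open S" "y \<in> S" "\<And>z. z \<in> S \<Longrightarrow> f z = g z"
  shows "ddir v f y = ddir v g y"
proof -
  have "(f has_derivative f') (at y) \<longleftrightarrow> (g has_derivative f') (at y)" for f'
    using has_derivative_transform_within_open[OF _ assms(1,2)] assms(3) by metis
  then show ?thesis by (simp add: ddir_def frechet_derivative_def)
qed

lemma ddir_const [simp]: "ddir v (\<lambda>y. c) = (\<lambda>y. 0)"
  by (simp add: ddir_def)

lemma has_derivative_ddir:
  "f differentiable (at y) \<Longrightarrow> (f has_derivative (\<lambda>v. ddir v f y)) (at y)"
  unfolding ddir_def by (simp add: frechet_derivative_works)

lemma linear_ddir: "f differentiable (at y) \<Longrightarrow> linear (\<lambda>v. ddir v f y)"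
  unfolding ddir_def using linear_frechet_derivative by blast

lemma ddir_bounded_linear:
  assumes "bounded_linear L" "f differentiable (at y)"
  shows "ddir v (\<lambda>z. L (f z)) y = L (ddir v f y)"
  by (rule ddir_eqI)
    (rule bounded_linear.has_derivative[OF assms(1) has_derivative_ddir[OF assms(2)]])

lemma ddir_add:
  assumes "f differentiable (at y)" "g differentiable (at y)"
  shows "ddir v (\<lambda>z. f z + g z) y = ddir v f y + ddir v g y"
  by (rule ddir_eqI) (intro has_derivative_add has_derivative_ddir assms)

lemma ddir_bilinear:
  assumes "bounded_bilinear P" "f differentiable (at y)" "g differentiable (at y)"
  shows "ddir v (\<lambda>z. P (f z) (g z)) y = P (f y) (ddir v g y) + P (ddir v f y) (g y)"
  by (rule ddir_eqI)
    (rule bounded_bilinear.FDERIV[OF assms(1) has_derivative_ddir[OF assms(2)] has_derivative_ddir[OF assms(3)]])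

lemma ddir_compose:
  fixes f :: "'a::euclidean_space \<Rightarrow> 'b::real_normed_vector"
  assumes "g differentiable (at y)" "f differentiable (at (g y))"
  shows "ddir v (\<lambda>z. f (g z)) y = ddir (ddir v g y) f (g y)"
  by (rule ddir_eqI)
    (use diff_chain_at[OF has_derivative_ddir[OF assms(1)] has_derivative_ddir[OF assms(2)]] in
      \<open>simp add: o_def\<close>)

section \<open>Closure properties of C^k maps\<close>

lemma Ck_on_differentiable:
  "Ck_on (Suc k) f S \<Longrightarrow> open S \<Longrightarrow> y \<in> S \<Longrightarrow> f differentiable (at y)"
  by (simp add: differentiable_on_eq_differentiable_at)

lemma Ck_on_SucI:
  assumes "open S" "\<And>y. y \<in> S \<Longrightarrow> f differentiable (at y)" "\<And>v. Ck_on k (ddir v f) S"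
  shows "Ck_on (Suc k) f S"
  using assms by (simp add: Ck_on_Suc differentiable_on_eq_differentiable_at del: Ck_on.simps)

text \<open>A differentiation rule describes \<open>ddir v f\<close> on \<open>S\<close> only. This
  carries regularity over from the right-hand side of the rule to the derivative, which is how most
  inductions below close.\<close>

lemma Ck_on_cong:
  assumes "open S"
  shows "Ck_on k f S \<Longrightarrow> (\<And>z. z \<in> S \<Longrightarrow> f z = g z) \<Longrightarrow> Ck_on k g S"
proof (induction k arbitrary: f g)
  case 0
  then show ?case using continuous_on_cong by force
next
  case (Suc k)
  show ?case
  proof (rule Ck_on_SucI[OF assms])
    show "g differentiable (at y)" if "y \<in> S" for y
      using Ck_on_differentiable[OF Suc.prems(1) assms that] Suc.prems(2) assms that
      by (meson differentiable_def has_derivative_transform_within_open)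
    show "Ck_on k (ddir v g) S" for v
      by (rule Suc.IH[OF Ck_on_ddir[OF Suc.prems(1)]])
        (use Suc.prems(2) in \<open>blast intro: ddir_cong[OF assms]\<close>)
  qed
qed

lemma Ck_on_mono: "Ck_on (Suc k) f S \<Longrightarrow> Ck_on k f S"
proof (induction k arbitrary: f)
  case 0
  then show ?case using differentiable_imp_continuous_on by auto
next
  case (Suc k)
  then show ?case by (metis Ck_on_Suc)
qed

lemma Ck_on_const: "Ck_on k (\<lambda>y. c) S"
  by (induction k arbitrary: c) (auto simp: differentiable_on_const)

lemma Ck_on_bounded_linear:
  assumes "open S" "bounded_linear L"
  shows "Ck_on k f S \<Longrightarrow> Ck_on k (\<lambda>y. L (f y)) S"
proof (induction k arbitrary: f)
  case 0
  then show ?case using assms bounded_linear.continuous_on by auto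
next
  case (Suc k)
  note d = Ck_on_differentiable[OF Suc.prems assms(1)]
  show ?case
  proof (rule Ck_on_SucI[OF assms(1)])
    show "(\<lambda>y. L (f y)) differentiable (at y)" if "y \<in> S" for y
      by (rule differentiableI)
        (rule bounded_linear.has_derivative[OF assms(2) has_derivative_ddir[OF d[OF that]]])
    show "Ck_on k (ddir v (\<lambda>y. L (f y))) S" for v
      by (rule Ck_on_cong[OF assms(1) Suc.IH[OF Ck_on_ddir[OF Suc.prems]]])
        (simp add: ddir_bounded_linear[OF assms(2) d])
  qed
qed

lemma Ck_on_id: "open S \<Longrightarrow> Ck_on k (\<lambda>y. y) S"
proof (cases k)
  case (Suc j)
  have "ddir v (\<lambda>y::'a. y) = (\<lambda>y. v)" for v by (simp add: ddir_def)
  then show ?thesis using Suc by (simp add: Ck_on_Suc Ck_on_const differentiable_on_ident del: Ck_on.simps)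
qed auto

lemma Ck_on_linear:
  assumes "open S" "bounded_linear L"
  shows "Ck_on k L S"
  using Ck_on_bounded_linear[OF assms Ck_on_id[OF assms(1)]] .

lemma Ck_on_add:
  assumes "open S"
  shows "Ck_on k f S \<Longrightarrow> Ck_on k g S \<Longrightarrow> Ck_on k (\<lambda>y. f y + g y) S"
proof (induction k arbitrary: f g)
  case 0
  then show ?case by (auto intro: continuous_on_add)
next
  case (Suc k)
  note d = Ck_on_differentiable[OF Suc.prems(1) assms] Ck_on_differentiable[OF Suc.prems(2) assms]
  show ?case
  proof (rule Ck_on_SucI[OF assms])
    show "(\<lambda>y. f y + g y) differentiable (at y)" if "y \<in> S" for y
      using d that by auto
    show "Ck_on k (ddir v (\<lambda>y. f y + g y)) S" for v
      by (rule Ck_on_cong[OF assms Suc.IH[OF Ck_on_ddir[OF Suc.prems(1)] Ck_on_ddir[OF Suc.prems(2)]]])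
        (simp add: ddir_add[OF d])
  qed
qed

lemma Ck_on_bilinear:
  assumes "open S" "bounded_bilinear P"
  shows "Ck_on k f S \<Longrightarrow> Ck_on k g S \<Longrightarrow> Ck_on k (\<lambda>y. P (f y) (g y)) S"
proof (induction k arbitrary: f g)
  case 0
  then show ?case using bounded_bilinear.continuous_on[OF assms(2)] by auto
next
  case (Suc k)
  note d = Ck_on_differentiable[OF Suc.prems(1) assms(1)] Ck_on_differentiable[OF Suc.prems(2) assms(1)]
  show ?case
  proof (rule Ck_on_SucI[OF assms(1)])
    show "(\<lambda>y. P (f y) (g y)) differentiable (at y)" if "y \<in> S" for y
      by (rule differentiableI) (rule bounded_bilinear.FDERIV[OF assms(2)
          has_derivative_ddir[OF d(1)[OF that]] has_derivative_ddir[OF d(2)[OF that]]])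
    have "Ck_on k f S" "Ck_on k g S" using Suc.prems Ck_on_mono by blast+
    moreover have "Ck_on k (ddir v f) S" "Ck_on k (ddir v g) S" for v
      using Suc.prems Ck_on_ddir by blast+
    ultimately have "Ck_on k (\<lambda>y. P (f y) (ddir v g y) + P (ddir v f y) (g y)) S" for v
      using Ck_on_add[OF assms(1)] Suc.IH by blast
    then show "Ck_on k (ddir v (\<lambda>y. P (f y) (g y))) S" for v
      by (rule Ck_on_cong[OF assms(1)]) (use ddir_bilinear[OF assms(2) d] in auto)
  qed
qed

lemma Ck_on_mult:
  fixes f g :: "'a::real_normed_vector \<Rightarrow> real"
  shows "open S \<Longrightarrow> Ck_on k f S \<Longrightarrow> Ck_on k g S \<Longrightarrow> Ck_on k (\<lambda>y. f y * g y) S"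
  using Ck_on_bilinear[OF _ bounded_bilinear_mult] .

lemma Ck_on_sum:
  assumes "open S" "\<And>i. i \<in> I \<Longrightarrow> Ck_on k (f i) S"
  shows "Ck_on k (\<lambda>y. \<Sum>i\<in>I. f i y) S"
  using assms(2) by (induction I rule: infinite_finite_induct) (auto intro!: Ck_on_const Ck_on_add assms(1))

lemma Ck_on_prod:
  fixes f :: "'i \<Rightarrow> 'a::real_normed_vector \<Rightarrow> real"
  assumes "open S" "\<And>i. i \<in> I \<Longrightarrow> Ck_on k (f i) S"
  shows "Ck_on k (\<lambda>y. \<Prod>i\<in>I. f i y) S"
  using assms(2) by (induction I rule: infinite_finite_induct) (auto intro!: Ck_on_const Ck_on_mult assms(1))

lemma Ck_on_inverse:
  fixes f :: "'a::real_normed_vector \<Rightarrow> real"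
  assumes "open S" "\<And>y. y \<in> S \<Longrightarrow> f y \<noteq> 0"
  shows "Ck_on k f S \<Longrightarrow> Ck_on k (\<lambda>y. inverse (f y)) S"
proof (induction k)
  case 0
  then show ?case using assms by (auto intro: continuous_on_inverse)
next
  case (Suc k)
  note d = Ck_on_differentiable[OF Suc.prems assms(1)]
  have D: "((\<lambda>y. inverse (f y)) has_derivative (\<lambda>v. - (inverse (f y) * ddir v f y * inverse (f y)))) (at y)"
    if "y \<in> S" for y
    by (rule Deriv.has_derivative_inverse) (use that assms d has_derivative_ddir in auto)
  show ?case
  proof (rule Ck_on_SucI[OF assms(1)])
    show "(\<lambda>y. inverse (f y)) differentiable (at y)" if "y \<in> S" for y
      using D[OF that] by (rule differentiableI)
    have "Ck_on k (\<lambda>y. inverse (f y)) S" "Ck_on k (ddir v f) S" for v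
      using Suc.IH Suc.prems Ck_on_mono Ck_on_ddir by blast+
    then have "Ck_on k (\<lambda>y. (-1) * (inverse (f y) * ddir v f y * inverse (f y))) S" for v
      by (intro Ck_on_mult Ck_on_const assms(1)) auto
    then show "Ck_on k (ddir v (\<lambda>y. inverse (f y))) S" for v
      by (rule Ck_on_cong[OF assms(1)]) (use ddir_eqI[OF D] in auto)
  qed
qed

text \<open>The chain rule yields \<open>ddir (ddir v g y) f (g y)\<close>, whose direction moves
  with \<open>y\<close>. Expanding that direction in \<open>Basis\<close> leaves sums of products,
  in which the induction hypothesis handles the derivatives of \<open>f\<close> along fixed
  directions, composed with the same \<open>g\<close>.\<close>

lemma Ck_on_compose:
  fixes f :: "'a::euclidean_space \<Rightarrow> 'b::real_normed_vector"
  assumes "open S" "open T" "\<And>y. y \<in> S \<Longrightarrow> g y \<in> T"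
  shows "Ck_on k f T \<Longrightarrow> Ck_on k g S \<Longrightarrow> Ck_on k (\<lambda>y. f (g y)) S"
proof (induction k arbitrary: f)
  case 0
  then show ?case using assms(3) continuous_on_compose2[of T f S g] by auto
next
  case (Suc k)
  note df = Ck_on_differentiable[OF Suc.prems(1) assms(2)]
  note dg = Ck_on_differentiable[OF Suc.prems(2) assms(1)]
  show ?case
  proof (rule Ck_on_SucI[OF assms(1)])
    show "(\<lambda>y. f (g y)) differentiable (at y)" if "y \<in> S" for y
      using differentiable_chain_at[OF dg df] assms(3) that by (simp add: o_def)
    have "Ck_on k g S" using Suc.prems Ck_on_mono by blast
    then have "Ck_on k (\<lambda>y. ddir b f (g y)) S" for b
      using Suc.IH[OF Ck_on_ddir[OF Suc.prems(1)]] by blast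
    moreover have "Ck_on k (\<lambda>y. ddir v g y \<bullet> b) S" for v b
      using Ck_on_bounded_linear[OF assms(1) bounded_linear_inner_left] Ck_on_ddir[OF Suc.prems(2)] by blast
    ultimately have "Ck_on k (\<lambda>y. \<Sum>b\<in>Basis. (ddir v g y \<bullet> b) *\<^sub>R ddir b f (g y)) S" for v
      by (intro Ck_on_sum Ck_on_bilinear[OF _ bounded_bilinear_scaleR] assms(1))
    then show "Ck_on k (ddir v (\<lambda>y. f (g y))) S" for v
    proof (rule Ck_on_cong[OF assms(1)])
      fix y assume y: "y \<in> S"
      interpret linear "\<lambda>v. ddir v f (g y)" using linear_ddir df assms(3) y by blast
      have "ddir (ddir v g y) f (g y) = ddir (\<Sum>b\<in>Basis. (ddir v g y \<bullet> b) *\<^sub>R b) f (g y)"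
        by (simp add: euclidean_representation)
      then show "(\<Sum>b\<in>Basis. (ddir v g y \<bullet> b) *\<^sub>R ddir b f (g y)) = ddir v (\<lambda>y. f (g y)) y"
        using ddir_compose[of g y f v] dg df assms(3) y by (simp add: sum scaleR)
    qed
  qed
qed

lemma Ck_on_vec_nth:
  assumes "open S" "\<And>i. Ck_on k (\<lambda>y. f y $ i) S"
  shows "Ck_on k (f :: 'a::real_normed_vector \<Rightarrow> real ^ 'n::finite) S"
proof -
  have "Ck_on k (\<lambda>y. \<Sum>i\<in>UNIV. (f y $ i) *\<^sub>R axis i 1) S"
    by (intro Ck_on_sum Ck_on_bilinear[OF _ bounded_bilinear_scaleR] Ck_on_const assms)
  then show ?thesis
    by (rule Ck_on_cong[OF assms(1)]) (simp add: basis_expansion flip: scalar_mult_eq_scaleR)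
qed

section \<open>Cramer's rule and the smooth inverse function theorem\<close>

lemma Ck_on_det:
  fixes a :: "'a::real_normed_vector \<Rightarrow> real ^ 'n::finite ^ 'n"
  assumes "open S" "\<And>i j. Ck_on k (\<lambda>y. a y $ i $ j) S"
  shows "Ck_on k (\<lambda>y. det (a y)) S"
  unfolding det_def by (intro Ck_on_sum Ck_on_mult Ck_on_prod Ck_on_const assms)

text \<open>By Cramer's rule each entry of the solution is a quotient of determinants, and these are
  polynomials in the entries of the system.\<close>

lemma Ck_on_matrix_solution:
  fixes a :: "'a::real_normed_vector \<Rightarrow> real ^ 'n::finite ^ 'n"
  assumes "open S" "\<And>i j. Ck_on k (\<lambda>y. a y $ i $ j) S"
    and "\<And>y. y \<in> S \<Longrightarrow> invertible (a y)" "\<And>y. y \<in> S \<Longrightarrow> a y *v s y = v"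
  shows "Ck_on k s S"
proof (rule Ck_on_vec_nth[OF assms(1)])
  fix l
  have det: "det (a y) \<noteq> 0" if "y \<in> S" for y
    using assms(3) that by (simp add: invertible_det_nz)
  have "Ck_on k (\<lambda>y. (\<chi> i j. if j = l then v $ i else a y $ i $ j) $ i $ j) S" for i j
    using assms(2) by (cases "j = l") (simp_all add: Ck_on_const)
  then have "Ck_on k (\<lambda>y. det (\<chi> i j. if j = l then v $ i else a y $ i $ j) * inverse (det (a y))) S"
    using det assms(1,2) by (intro Ck_on_mult Ck_on_inverse Ck_on_det) auto
  then show "Ck_on k (\<lambda>y. s y $ l) S"
  proof (rule Ck_on_cong[OF assms(1)])
    fix y assume "y \<in> S"
    then have "s y = (\<chi> k. det (\<chi> i j. if j = k then v $ i else a y $ i $ j) / det (a y))"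
      using cramer[OF det] assms(4) by blast
    then have "s y $ l = det (\<chi> i j. if j = l then v $ i else a y $ i $ j) / det (a y)"
      by (metis (no_types, lifting) vec_lambda_beta)
    then show "det (\<chi> i j. if j = l then v $ i else a y $ i $ j) * inverse (det (a y)) = s y $ l"
      by (simp add: divide_inverse)
  qed
qed

text \<open>Bootstrapping: differentiating \<open>F (g z) = z\<close> exhibits
  \<open>ddir v g z\<close> as the solution of a linear system whose matrix is the derivative of
  \<open>F\<close> at \<open>g z\<close>. If \<open>g\<close> is C^k, so is this matrix, hence so
  are the derivatives of \<open>g\<close>, and \<open>g\<close> gains one order.\<close>

lemma Ck_on_local_inverse:
  fixes F g :: "real ^ 'n::finite \<Rightarrow> real ^ 'n"
  assumes "open U" "open V" "smooth_on F U" "\<And>z. z \<in> V \<Longrightarrow> g z \<in> U"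
    and "\<And>z. z \<in> V \<Longrightarrow> F (g z) = z"
    and "\<And>z. z \<in> V \<Longrightarrow> g differentiable (at z)"
  shows "Ck_on k g V"
proof (induction k)
  case 0
  then show ?case using assms(6)
    by (simp add: differentiable_imp_continuous_on differentiable_on_eq_differentiable_at assms(2))
next
  case (Suc k)
  have F: "Ck_on k F U" "F differentiable_on U" "Ck_on k (ddir v F) U" for k v
    using assms(3) Ck_on_Suc unfolding smooth_on_def by blast+
  then have dF: "F differentiable (at y)" if "y \<in> U" for y
    using that assms(1) differentiable_on_eq_differentiable_at by blast
  define a where "a z = matrix (\<lambda>v. ddir v F (g z))" for z
  have lin: "linear (\<lambda>v. ddir v F (g z))" if "z \<in> V" for z
    using linear_ddir dF assms(4) that by blast
  have sol: "a z *v ddir v g z = v" if z: "z \<in> V" for z v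
  proof -
    have "ddir v (\<lambda>z. F (g z)) z = ddir v (\<lambda>z. z) z"
      by (rule ddir_cong[OF assms(2) z]) (use assms(5) in auto)
    then have "ddir (ddir v g z) F (g z) = v"
      using ddir_compose[of g z F v] assms(4,6) z dF by (simp add: ddir_def)
    then show ?thesis unfolding a_def using lin[OF z] by (simp add: matrix_works)
  qed
  have inv: "invertible (a z)" if "z \<in> V" for z
  proof -
    have "linear (\<lambda>v. ddir v g z)" using linear_ddir assms(6) that by blast
    then have "a z ** matrix (\<lambda>v. ddir v g z) = mat 1"
      using sol[OF that]
      by (auto simp: matrix_eq matrix_works simp flip: matrix_vector_mul_assoc)
    then show ?thesis using invertible_right_inverse by blast
  qed
  have "Ck_on k (\<lambda>z. a z $ i $ j) V" for i j
  proof -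
    have "Ck_on k (\<lambda>z. ddir (axis j 1) F (g z)) V"
      using Ck_on_compose[OF assms(2,1,4) F(3) Suc] by auto
    then have "Ck_on k (\<lambda>z. ddir (axis j 1) F (g z) $ i) V"
      by (rule Ck_on_bounded_linear[OF assms(2) bounded_linear_vec_nth])
    then show ?thesis by (simp add: a_def matrix_def)
  qed
  then have "Ck_on k (ddir v g) V" for v
    by (rule Ck_on_matrix_solution[OF assms(2) _ inv sol]) auto
  then show ?case using Ck_on_SucI[OF assms(2,6)] by blast
qed

lemma smooth_on_ddir: "smooth_on f S \<Longrightarrow> smooth_on (ddir v f) S"
  unfolding smooth_on_def using Ck_on_Suc by blast

lemma smooth_on_const: "smooth_on (\<lambda>y. c) S"
  unfolding smooth_on_def using Ck_on_const by blast

lemma smooth_on_bounded_linear: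
  "open S \<Longrightarrow> bounded_linear L \<Longrightarrow> smooth_on f S \<Longrightarrow> smooth_on (\<lambda>y. L (f y)) S"
  unfolding smooth_on_def using Ck_on_bounded_linear by blast

lemma smooth_on_linear: "open S \<Longrightarrow> bounded_linear L \<Longrightarrow> smooth_on L S"
  unfolding smooth_on_def using Ck_on_linear by blast

lemma smooth_on_add:
  "open S \<Longrightarrow> smooth_on f S \<Longrightarrow> smooth_on g S \<Longrightarrow> smooth_on (\<lambda>y. f y + g y) S"
  unfolding smooth_on_def using Ck_on_add by blast

lemma smooth_on_mult:
  fixes f g :: "'a::real_normed_vector \<Rightarrow> real"
  shows "open S \<Longrightarrow> smooth_on f S \<Longrightarrow> smooth_on g S \<Longrightarrow> smooth_on (\<lambda>y. f y * g y) S"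
  unfolding smooth_on_def using Ck_on_mult by blast

lemma smooth_on_sum:
  "open S \<Longrightarrow> (\<And>i. i \<in> I \<Longrightarrow> smooth_on (f i) S) \<Longrightarrow> smooth_on (\<lambda>y. \<Sum>i\<in>I. f i y) S"
  unfolding smooth_on_def by (intro allI Ck_on_sum) auto

lemma smooth_on_diff:
  fixes f g :: "'a::real_normed_vector \<Rightarrow> real"
  assumes "open S" "smooth_on f S" "smooth_on g S" shows "smooth_on (\<lambda>y. f y - g y) S"
  using smooth_on_add[OF assms(1,2) smooth_on_mult[OF assms(1) smooth_on_const assms(3)], of "-1"]
  by simp

lemma smooth_on_compose:
  fixes f :: "'a::euclidean_space \<Rightarrow> 'b::real_normed_vector"
  shows "open S \<Longrightarrow> open T \<Longrightarrow> (\<And>y. y \<in> S \<Longrightarrow> g y \<in> T) \<Longrightarrow> smooth_on f T \<Longrightarrow> smooth_on g S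
    \<Longrightarrow> smooth_on (\<lambda>y. f (g y)) S"
  unfolding smooth_on_def using Ck_on_compose by blast

lemma smooth_on_continuous: "smooth_on f S \<Longrightarrow> continuous_on S f"
  unfolding smooth_on_def using Ck_on.simps(1) by blast

text \<open>The C^1 theorem supplies a differentiable inverse, and
  \<open>Ck_on_local_inverse\<close> raises it to every order. Bijectivity of its derivative is
  recorded because tangent frames are later pulled back through it.\<close>

theorem smooth_inverse_function:
  fixes F :: "real ^ 'n::finite \<Rightarrow> real ^ 'n"
  assumes "open U" "smooth_on F U" "y0 \<in> U" "inj (\<lambda>v. ddir v F y0)"
  obtains U' V g where "open U'" "U' \<subseteq> U" "y0 \<in> U'" "open V" "F y0 \<in> V"
    "homeomorphism U' V F g" "smooth_on g V" "\<And>z. z \<in> V \<Longrightarrow> bij (\<lambda>v. ddir v g z)"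
proof -
  have dF: "F differentiable (at y)" if "y \<in> U" for y
    using smooth_on_differentiable assms(1,2) that by blast
  define F' where "F' y = Blinfun (\<lambda>v. ddir v F y)" for y
  have F': "blinfun_apply (F' y) v = ddir v F y" if "y \<in> U" for y v
    unfolding F'_def using bounded_linear_Blinfun_apply linear_ddir[OF dF[OF that]] linear_linear by metis
  \<comment> \<open>In finite dimension an operator-valued map is continuous as soon as its values
    on each fixed vector are.\<close>
  have c: "continuous_on U F'"
  proof (rule continuous_on_blinfun_componentwise)
    fix i :: "real ^ 'n"
    have "continuous_on U (ddir i F)" using smooth_on_continuous smooth_on_ddir assms(2) by blast
    then show "continuous_on U (\<lambda>y. F' y i)" using continuous_on_cong F' by force
  qed
  have lin0: "linear (\<lambda>v. ddir v F y0)" using linear_ddir dF assms(3) by blast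
  then obtain G where G: "linear G" "G \<circ> (\<lambda>v. ddir v F y0) = id"
    using linear_injective_left_inverse assms(4) by blast
  have "Blinfun G o\<^sub>L F' y0 = id_blinfun"
    using G F' assms(3)
    by (intro blinfun_eqI) (simp add: bounded_linear_Blinfun_apply linear_linear o_def fun_eq_iff)
  moreover have "(F has_derivative blinfun_apply (F' y)) (at y)" if "y \<in> U" for y
    using has_derivative_ddir[OF dF[OF that]] F'[OF that] by presburger
  ultimately obtain U' V g g' where *: "open U'" "U' \<subseteq> U" "y0 \<in> U'" "open V" "F y0 \<in> V"
      "homeomorphism U' V F g" "\<And>y. y \<in> V \<Longrightarrow> (g has_derivative (g' y)) (at y)"
      "\<And>y. y \<in> V \<Longrightarrow> g' y = inv (blinfun_apply (F'(g y)))"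
      "\<And>y. y \<in> V \<Longrightarrow> bij (blinfun_apply (F'(g y)))"
    using inverse_function_theorem[OF assms(1) _ c assms(3)] by metis
  have "bij (\<lambda>v. ddir v g z)" if "z \<in> V" for z
  proof -
    have "(\<lambda>v. ddir v g z) = g' z" using ddir_eqI *(7)[OF that] by blast
    then show ?thesis using *(8,9)[OF that] bij_imp_bij_inv by metis
  qed
  moreover have "smooth_on g V"
    unfolding smooth_on_def
  proof
    show "Ck_on k g V" for k
      by (rule Ck_on_local_inverse[OF assms(1) *(4) assms(2)])
        (use *(2,6,7) in \<open>auto simp: homeomorphism_def differentiable_def\<close>)
  qed
  ultimately show thesis using that * by metis
qed

text \<open>The mixed second difference of \<open>F\<close> over a small parallelogram is symmetric
  in \<open>a\<close> and \<open>b\<close>. It equals \<open>t\<^sup>2\<close> times either mixed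
  derivative at some nearby point, so continuity of both at \<open>z\<close> forces them to
  agree.\<close>

lemma ddir_swap:
  fixes F :: "'a::real_normed_vector \<Rightarrow> real"
  assumes "open S" "smooth_on F S" "z \<in> S"
  shows "ddir a (ddir b F) z = ddir b (ddir a F) z"
proof -
  \<comment> \<open>Two mean value theorems: first along \<open>a\<close> for the difference in
    direction \<open>b\<close>, then along \<open>b\<close> for \<open>ddir a F\<close>.\<close>
  have mean: "\<exists>p. norm (p - z) \<le> t * (norm a + norm b) \<and>
      F (z + t *\<^sub>R a + t *\<^sub>R b) - F (z + t *\<^sub>R a) - F (z + t *\<^sub>R b) + F z = t\<^sup>2 * ddir b (ddir a F) p"
    if t: "0 < t" and sub: "cball z (t * (norm a + norm b)) \<subseteq> S" for t a b
  proof -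
    have nb: "norm (s *\<^sub>R a + r *\<^sub>R b) \<le> t * (norm a + norm b)"
      if "0 \<le> s" "s \<le> t" "0 \<le> r" "r \<le> t" for s r
    proof -
      have "norm (s *\<^sub>R a + r *\<^sub>R b) \<le> s * norm a + r * norm b"
        using norm_triangle_ineq[of "s *\<^sub>R a" "r *\<^sub>R b"] that by simp
      also have "\<dots> \<le> t * norm a + t * norm b"
        using that by (intro add_mono mult_right_mono) auto
      finally show ?thesis by (simp add: algebra_simps)
    qed
    have inS: "z + s *\<^sub>R a + r *\<^sub>R b \<in> S" if "0 \<le> s" "s \<le> t" "0 \<le> r" "r \<le> t" for s r
    proof -
      have "dist z (z + s *\<^sub>R a + r *\<^sub>R b) \<le> t * (norm a + norm b)"
        using nb[OF that] norm_minus_cancel[of "s *\<^sub>R a + r *\<^sub>R b"] by (simp add: dist_norm add.assoc)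
      then show ?thesis using sub by auto
    qed
    have dF: "(F has_derivative (\<lambda>v. ddir v F y)) (at y)" if "y \<in> S" for y
      using has_derivative_ddir smooth_on_differentiable assms(1,2) that by blast
    have dG: "(ddir a F has_derivative (\<lambda>v. ddir v (ddir a F) y)) (at y)" if "y \<in> S" for y
      using has_derivative_ddir smooth_on_differentiable smooth_on_ddir assms(1,2) that by blast
    have lin: "ddir (c *\<^sub>R v) G y = c * ddir v G y" if "G differentiable (at y)" for c v y and G :: "'a \<Rightarrow> real"
      using linear_cmul[OF linear_ddir[OF that]] by simp
    define G where "G s = F (z + s *\<^sub>R a + t *\<^sub>R b) - F (z + s *\<^sub>R a)" for s
    have "\<exists>s>0. s < t \<and> G t - G 0 = (t - 0) * (ddir a F (z + s *\<^sub>R a + t *\<^sub>R b) - ddir a F (z + s *\<^sub>R a))"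
    proof (rule MVT2[OF t])
      fix s assume s: "0 \<le> s" "s \<le> t"
      have "((\<lambda>s. F (z + s *\<^sub>R a + t *\<^sub>R b)) has_derivative (\<lambda>h. ddir (h *\<^sub>R a) F (z + s *\<^sub>R a + t *\<^sub>R b))) (at s)"
        by (rule has_derivative_compose[of _ "\<lambda>h. h *\<^sub>R a" s UNIV F "\<lambda>v. ddir v F (z + s *\<^sub>R a + t *\<^sub>R b)"])
          (auto intro!: derivative_eq_intros dF inS s t less_imp_le)
      moreover have "((\<lambda>s. F (z + s *\<^sub>R a)) has_derivative (\<lambda>h. ddir (h *\<^sub>R a) F (z + s *\<^sub>R a))) (at s)"
        by (rule has_derivative_compose[of _ "\<lambda>h. h *\<^sub>R a" s UNIV F "\<lambda>v. ddir v F (z + s *\<^sub>R a)"])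
          (use inS[OF s, of 0] t in \<open>auto intro!: derivative_eq_intros dF\<close>)
      ultimately have "(G has_derivative (\<lambda>h. ddir (h *\<^sub>R a) F (z + s *\<^sub>R a + t *\<^sub>R b)
          - ddir (h *\<^sub>R a) F (z + s *\<^sub>R a))) (at s)"
        unfolding G_def by (rule has_derivative_diff)
      moreover have "F differentiable (at (z + s *\<^sub>R a + t *\<^sub>R b))" "F differentiable (at (z + s *\<^sub>R a))"
        using inS[OF s, of t] inS[OF s, of 0] t dF unfolding differentiable_def by auto
      ultimately show "(G has_real_derivative (ddir a F (z + s *\<^sub>R a + t *\<^sub>R b) - ddir a F (z + s *\<^sub>R a))) (at s)"
        by (simp add: has_field_derivative_def lin mult_commute_abs flip: right_diff_distrib)
    qed
    then obtain s where s: "0 < s" "s < t"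
      and Gs: "G t - G 0 = t * (ddir a F (z + s *\<^sub>R a + t *\<^sub>R b) - ddir a F (z + s *\<^sub>R a))" by auto
    have "\<exists>r>0. r < t \<and> ddir a F (z + s *\<^sub>R a + t *\<^sub>R b) - ddir a F (z + s *\<^sub>R a + 0 *\<^sub>R b)
        = (t - 0) * ddir b (ddir a F) (z + s *\<^sub>R a + r *\<^sub>R b)"
    proof (rule MVT2[OF t])
      fix r assume r: "0 \<le> r" "r \<le> t"
      have zS: "z + s *\<^sub>R a + r *\<^sub>R b \<in> S" using inS s r by auto
      have "((\<lambda>r. ddir a F (z + s *\<^sub>R a + r *\<^sub>R b)) has_derivative
          (\<lambda>h. ddir (h *\<^sub>R b) (ddir a F) (z + s *\<^sub>R a + r *\<^sub>R b))) (at r)"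
        by (rule has_derivative_compose[of _ "\<lambda>h. h *\<^sub>R b" r UNIV "ddir a F" "\<lambda>v. ddir v (ddir a F) (z + s *\<^sub>R a + r *\<^sub>R b)"])
          (auto intro!: derivative_eq_intros dG zS)
      moreover have "ddir a F differentiable (at (z + s *\<^sub>R a + r *\<^sub>R b))"
        using dG zS unfolding differentiable_def by auto
      ultimately show "((\<lambda>r. ddir a F (z + s *\<^sub>R a + r *\<^sub>R b)) has_real_derivative
          ddir b (ddir a F) (z + s *\<^sub>R a + r *\<^sub>R b)) (at r)"
        by (simp add: has_field_derivative_def lin mult_commute_abs)
    qed
    then obtain r where r: "0 < r" "r < t"
      and Gr: "ddir a F (z + s *\<^sub>R a + t *\<^sub>R b) - ddir a F (z + s *\<^sub>R a)
        = t * ddir b (ddir a F) (z + s *\<^sub>R a + r *\<^sub>R b)" by auto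
    show ?thesis
    proof (intro exI conjI)
      show "norm (z + s *\<^sub>R a + r *\<^sub>R b - z) \<le> t * (norm a + norm b)"
        using nb[of s r] s r by (simp add: add.assoc)
      show "F (z + t *\<^sub>R a + t *\<^sub>R b) - F (z + t *\<^sub>R a) - F (z + t *\<^sub>R b) + F z
          = t\<^sup>2 * ddir b (ddir a F) (z + s *\<^sub>R a + r *\<^sub>R b)"
        using Gs Gr by (simp add: G_def power2_eq_square)
    qed
  qed
  define N where "N = norm a + norm b + 1"
  have N: "N > 0" by (simp add: N_def add_nonneg_pos)
  let ?A = "ddir a (ddir b F)" and ?B = "ddir b (ddir a F)"
  have cont: "isCont ?A z" "isCont ?B z"
    using smooth_on_continuous[OF smooth_on_ddir[OF smooth_on_ddir[OF assms(2)]]]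
    by (auto simp: continuous_on_eq_continuous_at[OF assms(1)] assms(3))
  show ?thesis
  proof (rule ccontr)
    assume ne: "?A z \<noteq> ?B z"
    define e where "e = \<bar>?A z - ?B z\<bar> / 2"
    have "e > 0" using ne by (simp add: e_def)
    obtain d1 where d1: "d1 > 0" "\<And>y. dist y z < d1 \<Longrightarrow> dist (?A y) (?A z) < e"
      using cont(1) \<open>e > 0\<close> unfolding continuous_at_eps_delta by blast
    obtain d2 where d2: "d2 > 0" "\<And>y. dist y z < d2 \<Longrightarrow> dist (?B y) (?B z) < e"
      using cont(2) \<open>e > 0\<close> unfolding continuous_at_eps_delta by blast
    obtain d3 where d3: "d3 > 0" "ball z d3 \<subseteq> S" using assms(1,3) openE by blast
    \<comment> \<open>As \<open>N\<close> exceeds \<open>norm a + norm b\<close>, the points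
      \<open>p\<close> and \<open>q\<close> below lie strictly within all three radii.\<close>
    define t where "t = min d1 (min d2 d3) / N"
    have t: "t > 0" using d1 d2 d3 N by (simp add: t_def)
    have "t * (norm a + norm b) < t * N" using t by (simp add: N_def)
    also have "\<dots> = min d1 (min d2 d3)" using N by (simp add: t_def)
    finally have tl: "t * (norm a + norm b) < min d1 (min d2 d3)" .
    then have "cball z (t * (norm a + norm b)) \<subseteq> S" using d3(2) by (auto simp: subset_iff)
    then obtain p q where p: "norm (p - z) \<le> t * (norm a + norm b)"
        "F (z + t *\<^sub>R a + t *\<^sub>R b) - F (z + t *\<^sub>R a) - F (z + t *\<^sub>R b) + F z = t\<^sup>2 * ?B p"
      and q: "norm (q - z) \<le> t * (norm a + norm b)"
        "F (z + t *\<^sub>R b + t *\<^sub>R a) - F (z + t *\<^sub>R b) - F (z + t *\<^sub>R a) + F z = t\<^sup>2 * ?A q"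
      using mean[OF t, of a b] mean[OF t, of b a] by (auto simp: add.commute)
    have eq: "z + t *\<^sub>R b + t *\<^sub>R a = z + t *\<^sub>R a + t *\<^sub>R b" by simp
    have "t\<^sup>2 * ?A q = t\<^sup>2 * ?B p" using p(2) q(2)[unfolded eq] by linarith
    then have "?A q = ?B p" using t by simp
    moreover have "dist (?A q) (?A z) < e" "dist (?B p) (?B z) < e"
      using p(1) q(1) tl d1(2) d2(2) by (auto simp: dist_norm)
    ultimately show False unfolding e_def dist_real_def by (simp add: abs_if split: if_splits)
  qed
qed

section \<open>Second order calculus at a point\<close>

abbreviation pdir :: "'n::finite \<Rightarrow> (real ^ 'n \<Rightarrow> real) \<Rightarrow> real ^ 'n \<Rightarrow> real" where
  "pdir i \<equiv> ddir (axis i 1)"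

context
  fixes V :: "'a::euclidean_space set"
  assumes V: "open V"
begin

lemma ddir_mult_on:
  fixes f g :: "'a \<Rightarrow> real"
  assumes "smooth_on f V" "smooth_on g V" "z \<in> V"
  shows "ddir v (\<lambda>y. f y * g y) z = f z * ddir v g z + ddir v f z * g z"
  by (rule ddir_bilinear[OF bounded_bilinear_mult]) (rule smooth_on_differentiable[OF _ V]; fact)+

lemma ddir_add_on:
  fixes f g :: "'a \<Rightarrow> real"
  assumes "smooth_on f V" "smooth_on g V" "z \<in> V"
  shows "ddir v (\<lambda>y. f y + g y) z = ddir v f z + ddir v g z"
  by (rule ddir_add) (rule smooth_on_differentiable[OF _ V]; fact)+

lemma ddir_sum_on:
  fixes f :: "'i \<Rightarrow> 'a \<Rightarrow> real"
  assumes "\<And>i. smooth_on (f i) V" "z \<in> V"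
  shows "ddir v (\<lambda>y. \<Sum>i\<in>I. f i y) z = (\<Sum>i\<in>I. ddir v (f i) z)"
  by (rule ddir_eqI) (intro has_derivative_sum has_derivative_ddir smooth_on_differentiable[OF _ V] assms)

lemma ddir_cmult_on:
  fixes f :: "'a \<Rightarrow> real"
  assumes "smooth_on f V" "z \<in> V"
  shows "ddir v (\<lambda>y. c * f y) z = c * ddir v f z"
  using ddir_mult_on[OF smooth_on_const assms] by simp

lemma ddir_diff_on:
  fixes f g :: "'a \<Rightarrow> real"
  assumes "smooth_on f V" "smooth_on g V" "z \<in> V"
  shows "ddir v (\<lambda>y. f y - g y) z = ddir v f z - ddir v g z"
  using ddir_add_on[OF assms(1) smooth_on_mult[OF V smooth_on_const assms(2)] assms(3), of v "-1"]
    ddir_cmult_on[OF assms(2,3), of v "-1"] by simp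

lemma ddir2_mult_on:
  fixes f g :: "'a \<Rightarrow> real"
  assumes f: "smooth_on f V" and g: "smooth_on g V" and z: "z \<in> V"
  shows "ddir w (ddir v (\<lambda>y. f y * g y)) z
    = f z * ddir w (ddir v g) z + ddir w f z * ddir v g z
      + ddir v f z * ddir w g z + ddir w (ddir v f) z * g z"
proof -
  note s = f g smooth_on_ddir[OF f] smooth_on_ddir[OF g]
  have "ddir w (ddir v (\<lambda>y. f y * g y)) z = ddir w (\<lambda>y. f y * ddir v g y + ddir v f y * g y) z"
    by (rule ddir_cong[OF V z]) (rule ddir_mult_on[OF f g])
  also have "\<dots> = ddir w (\<lambda>y. f y * ddir v g y) z + ddir w (\<lambda>y. ddir v f y * g y) z"
    by (intro ddir_add_on smooth_on_mult V s z)
  finally show ?thesis by (simp add: ddir_mult_on s z)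
qed

lemma ddir2_add_on:
  fixes f g :: "'a \<Rightarrow> real"
  assumes "smooth_on f V" "smooth_on g V" "z \<in> V"
  shows "ddir w (ddir v (\<lambda>y. f y + g y)) z = ddir w (ddir v f) z + ddir w (ddir v g) z"
  by (rule trans[OF ddir_cong[OF V assms(3) ddir_add_on[OF assms(1,2)]]
      ddir_add_on[OF smooth_on_ddir[OF assms(1)] smooth_on_ddir[OF assms(2)] assms(3)]])

lemma ddir2_diff_on:
  fixes f g :: "'a \<Rightarrow> real"
  assumes "smooth_on f V" "smooth_on g V" "z \<in> V"
  shows "ddir w (ddir v (\<lambda>y. f y - g y)) z = ddir w (ddir v f) z - ddir w (ddir v g) z"
  by (rule trans[OF ddir_cong[OF V assms(3) ddir_diff_on[OF assms(1,2)]]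
      ddir_diff_on[OF smooth_on_ddir[OF assms(1)] smooth_on_ddir[OF assms(2)] assms(3)]])

lemma ddir2_cmult_on:
  fixes f :: "'a \<Rightarrow> real"
  assumes "smooth_on f V" "z \<in> V"
  shows "ddir w (ddir v (\<lambda>y. c * f y)) z = c * ddir w (ddir v f) z"
  using ddir2_mult_on[OF smooth_on_const assms] by simp

lemma ddir2_sum_on:
  fixes f :: "'i \<Rightarrow> 'a \<Rightarrow> real"
  assumes "\<And>i. smooth_on (f i) V" "z \<in> V"
  shows "ddir w (ddir v (\<lambda>y. \<Sum>i\<in>I. f i y)) z = (\<Sum>i\<in>I. ddir w (ddir v (f i)) z)"
  by (rule trans[OF ddir_cong[OF V assms(2) ddir_sum_on[OF assms(1)]]
      ddir_sum_on[OF smooth_on_ddir[OF assms(1)] assms(2)]])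

text \<open>Used at a critical point, where products of gradient entries and coordinates have only
  the mixed terms left.\<close>

lemma ddir2_mult_vanish:
  fixes f g :: "'a \<Rightarrow> real"
  assumes "smooth_on f V" "smooth_on g V" "z \<in> V" "f z = 0" "g z = 0"
  shows "ddir w (ddir v (\<lambda>y. f y * g y)) z = ddir w f z * ddir v g z + ddir v f z * ddir w g z"
  using ddir2_mult_on[OF assms(1-3)] assms(4,5) by simp

end

section \<open>Partial derivatives, and derivative tests at a maximum\<close>

lemma ddir_expand:
  fixes F :: "real ^ 'n::finite \<Rightarrow> real"
  assumes "F differentiable (at z)"
  shows "ddir v F z = (\<Sum>i\<in>UNIV. v $ i * pdir i F z)"
proof -
  interpret linear "\<lambda>v. ddir v F z" using linear_ddir assms by blast
  have "ddir v F z = ddir (\<Sum>i\<in>UNIV. (v $ i) *\<^sub>R axis i 1) F z"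
    by (simp add: basis_expansion flip: scalar_mult_eq_scaleR)
  then show ?thesis by (simp add: sum scaleR)
qed

lemma ddir2_expand:
  fixes F :: "real ^ 'n::finite \<Rightarrow> real"
  assumes "open V" "smooth_on F V" "z \<in> V"
  shows "ddir w (ddir v F) z = (\<Sum>i\<in>UNIV. \<Sum>j\<in>UNIV. v $ i * w $ j * pdir j (pdir i F) z)"
proof -
  note s = assms(1,2) smooth_on_ddir[OF assms(2)] smooth_on_const assms(3)
  have "ddir w (ddir v F) z = ddir w (\<lambda>y. \<Sum>i\<in>UNIV. v $ i * pdir i F y) z"
    by (rule ddir_cong[OF assms(1,3)], rule ddir_expand) (use smooth_on_differentiable s in blast)
  also have "\<dots> = (\<Sum>i\<in>UNIV. v $ i * ddir w (pdir i F) z)"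
    by (subst ddir_sum_on[OF assms(1)]) (auto intro!: smooth_on_mult s simp: ddir_cmult_on[OF assms(1) smooth_on_ddir[OF assms(2)] assms(3)])
  also have "\<dots> = (\<Sum>i\<in>UNIV. \<Sum>j\<in>UNIV. v $ i * w $ j * pdir j (pdir i F) z)"
    by (subst ddir_expand) (use smooth_on_differentiable s in \<open>auto simp: sum_distrib_left mult.assoc\<close>)
  finally show ?thesis .
qed

lemma ddir_local_max:
  fixes F :: "'a::real_normed_vector \<Rightarrow> real"
  assumes "open V" "smooth_on F V" "z \<in> V" "\<And>y. y \<in> V \<Longrightarrow> F y \<le> F z"
  shows "ddir v F z = 0"
proof -
  have d: "(F has_derivative (\<lambda>v. ddir v F z)) (at z)"
    using has_derivative_ddir smooth_on_differentiable assms by blast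
  have "eventually (\<lambda>y. F y \<le> F z) (at z)"
    using assms eventually_at_topological by blast
  then show ?thesis using has_derivative_local_max[OF d] by metis
qed

text \<open>On the line through \<open>z\<close> in direction \<open>v\<close> the first derivative
  vanishes at 0. Were the second one positive, the first would be positive just to the right of 0,
  and the mean value theorem would produce a value above the maximum.\<close>

lemma ddir2_local_max:
  fixes F :: "'a::real_normed_vector \<Rightarrow> real"
  assumes "open V" "smooth_on F V" "z \<in> V" "\<And>y. y \<in> V \<Longrightarrow> F y \<le> F z"
  shows "ddir v (ddir v F) z \<le> 0"
proof (rule ccontr)
  assume neg: "\<not> ?thesis"
  define g where "g t = F (z + t *\<^sub>R v)" for t
  define g' where "g' t = ddir v F (z + t *\<^sub>R v)" for t
  have line: "((\<lambda>t. G (z + t *\<^sub>R v)) has_real_derivative ddir v G (z + t *\<^sub>R v)) (at t)"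
    if "z + t *\<^sub>R v \<in> V" "smooth_on G V" for t and G :: "'a \<Rightarrow> real"
  proof -
    have d: "G differentiable (at (z + t *\<^sub>R v))" using smooth_on_differentiable assms(1) that by blast
    have "((\<lambda>t. G (z + t *\<^sub>R v)) has_derivative (\<lambda>h. ddir (h *\<^sub>R v) G (z + t *\<^sub>R v))) (at t)"
      by (rule has_derivative_compose[of _ "\<lambda>h. h *\<^sub>R v" t UNIV G "\<lambda>w. ddir w G (z + t *\<^sub>R v)"])
        (auto intro!: derivative_eq_intros has_derivative_ddir d)
    then show ?thesis
      using linear_cmul[OF linear_ddir[OF d]] by (simp add: has_field_derivative_def mult_commute_abs)
  qed
  obtain r where r: "r > 0" "ball z r \<subseteq> V" using assms(1,3) openE by blast
  \<comment> \<open>The summand 1 keeps the quotient meaningful for \<open>v = 0\<close>.\<close>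
  define \<delta> where "\<delta> = r / (norm v + 1)"
  have pos: "norm v + 1 > 0" by (simp add: add_nonneg_pos)
  have \<delta>: "\<delta> > 0" using r pos by (simp add: \<delta>_def)
  have inV: "z + t *\<^sub>R v \<in> V" if "0 \<le> t" "t < \<delta>" for t
  proof -
    have "t * norm v \<le> t * (norm v + 1)" using that by (simp add: mult_left_mono)
    also have "\<dots> < \<delta> * (norm v + 1)" using that pos by simp
    also have "\<dots> = r" using pos by (simp add: \<delta>_def)
    finally show ?thesis using r(2) that by (auto simp: dist_norm)
  qed
  have g: "(g has_real_derivative g' t) (at t)" if "0 \<le> t" "t < \<delta>" for t
    unfolding g_def g'_def using line[OF inV[OF that] assms(2)] .
  have g'0: "g' 0 = 0" using ddir_local_max[OF assms] by (simp add: g'_def)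
  have "(g' has_real_derivative ddir v (ddir v F) z) (at 0)"
    using line[of 0 "ddir v F", OF _ smooth_on_ddir[OF assms(2)]] assms(3) by (simp add: g'_def[abs_def])
  then obtain \<epsilon> where \<epsilon>: "\<epsilon> > 0" "\<And>h. 0 < h \<Longrightarrow> h < \<epsilon> \<Longrightarrow> g' 0 < g' (0 + h)"
    using DERIV_pos_inc_right[of g' "ddir v (ddir v F) z" 0] neg by (auto simp: not_le)
  define t where "t = min \<delta> \<epsilon> / 2"
  have t: "0 < t" "t < \<delta>" "t < \<epsilon>" using \<delta> \<epsilon>(1) by (auto simp: t_def)
  obtain s where s: "0 < s" "s < t" "g t - g 0 = (t - 0) * g' s"
    using MVT2[OF t(1), of g g'] g t by force
  then have "t * g' s > 0" using \<epsilon>(2)[of s] g'0 t by simp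
  then have "g t > g 0" using s(3) by simp
  then show False using assms(4)[OF inV[of t]] t by (simp add: g_def)
qed

section \<open>The Simons inequality for a graph\<close>

text \<open>Here \<open>f\<close> is the height of a graph, \<open>\<theta>\<close> the vertical
  component of its unit normal, and \<open>B\<close> the matrix \<theta> (I - \<theta>^2 p p^T) Hess
  f of the shape operator, where p is the gradient of \<open>f\<close> and the middle factor is the
  inverse metric. Thus \<open>mean\<close> is the self-expander equation and \<open>const\<close>
  says tr B^2 = S. The Hessian of \<open>mean\<close>, contracted with \<open>h\<close>, is compared
  with the Laplacian of \<open>const\<close>, both at 0, where the gradient vanishes and
  \<open>B\<close> equals \<open>h\<close>.\<close>

theorem graph_simons_inequality:
  fixes f \<theta> :: "real ^ 'n::finite \<Rightarrow> real"
    and B :: "'n \<Rightarrow> 'n \<Rightarrow> real ^ 'n \<Rightarrow> real"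
  assumes V: "open V" "0 \<in> V" and f: "smooth_on f V" and \<theta>: "smooth_on \<theta> V"
    and \<theta>1: "\<theta> 0 = 1" and crit: "\<And>k. pdir k f 0 = 0"
    and norm: "\<And>z. z \<in> V \<Longrightarrow> \<theta> z * \<theta> z * (1 + (\<Sum>k\<in>UNIV. pdir k f z * pdir k f z)) = 1"
    and B: "\<And>k l z. B k l z = \<theta> z * pdir l (pdir k f) z
      - \<theta> z * (\<theta> z * \<theta> z) * (pdir k f z * (\<Sum>a\<in>UNIV. pdir a f z * pdir l (pdir a f) z))"
    and mean: "\<And>z. z \<in> V \<Longrightarrow>
      (\<Sum>k\<in>UNIV. B k k z) = lam + 1 / 2 * (\<theta> z * (f z - (\<Sum>k\<in>UNIV. z $ k * pdir k f z)))"
    and const: "\<And>z. z \<in> V \<Longrightarrow> (\<Sum>k\<in>UNIV. \<Sum>l\<in>UNIV. B k l z * B l k z) = s"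
  defines "h \<equiv> \<lambda>k l. pdir l (pdir k f) 0"
  shows "lam * (\<Sum>i\<in>UNIV. \<Sum>j\<in>UNIV. h i j * (\<Sum>a\<in>UNIV. h i a * h a j))
    \<le> (\<Sum>i\<in>UNIV. \<Sum>j\<in>UNIV. h i j * h i j)\<^sup>2 + (\<Sum>i\<in>UNIV. \<Sum>j\<in>UNIV. h i j * h i j) / 2"
    and "(\<Sum>k\<in>UNIV. h k k) = lam + f 0 / 2"
    and "(\<Sum>i\<in>UNIV. \<Sum>j\<in>UNIV. h i j * h i j) = s"
proof -
  note ld = smooth_on_ddir
  have coord: "smooth_on (\<lambda>z::real^'n. z $ k) V" for k
    by (rule smooth_on_linear[OF V(1) bounded_linear_vec_nth])
  note sm = V(1) f \<theta> ld smooth_on_const smooth_on_mult smooth_on_sum smooth_on_add smooth_on_diff coord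
  note D1 = ddir_mult_on[OF V(1)] ddir_sum_on[OF V(1)] ddir_add_on[OF V(1)] ddir_diff_on[OF V(1)]
  note D2 = ddir2_sum_on[OF V(1)] ddir2_add_on[OF V(1)] ddir2_diff_on[OF V(1)]
  define h2 where "h2 i j = (\<Sum>a\<in>UNIV. h i a * h a j)" for i j
  define h4 where "h4 k l i j = pdir j (pdir i (pdir l (pdir k f))) 0" for k l i j
  define h3 where "h3 k l i = pdir i (pdir l (pdir k f)) 0" for k l i
  have h_app: "pdir l (pdir k f) 0 = h k l" for k l by (simp add: h_def)
  have sym: "h k l = h l k" for k l
    unfolding h_def by (rule ddir_swap[OF V(1) f V(2)])
  have sym2: "h2 k l = h2 l k" for k l
    unfolding h2_def by (rule sum.cong) (auto simp: sym mult.commute)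
  \<comment> \<open>This will turn the Laplacian terms \<open>h4 k l i i\<close> into terms
    \<open>h4 i i k l\<close> from the Hessian of the trace. As partial derivatives commute, the
    curvature terms of the Simons identity come from the cubic corrections in \<open>B2\<close>
    instead.\<close>
  have h4_swap: "h4 k l i j = h4 i j k l" for k l i j
  proof -
    have 1: "pdir j (pdir i g) z = pdir i (pdir j g) z" if "smooth_on g V" "z \<in> V" for i j g z
      by (rule ddir_swap[OF V(1) that])
    have 2: "pdir k (pdir j (pdir i g)) 0 = pdir k (pdir i (pdir j g)) 0" if "smooth_on g V" for i j k g
      by (rule ddir_cong[OF V 1[OF that]])
    have 3: "pdir l (pdir k (pdir j (pdir i g))) 0 = pdir l (pdir k (pdir i (pdir j g))) 0"
      if "smooth_on g V" for i j k l g
      by (rule ddir_cong[OF V], rule ddir_cong[OF V(1)], assumption, rule 1[OF that])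
    have "pdir j (pdir i (pdir l (pdir k f))) 0 = pdir j (pdir l (pdir i (pdir k f))) 0"
      by (rule 2) (intro sm)
    also have "\<dots> = pdir j (pdir l (pdir k (pdir i f))) 0"
      by (rule 3) (intro sm)
    also have "\<dots> = pdir l (pdir j (pdir k (pdir i f))) 0"
      by (rule 1) (intro sm V)+
    also have "\<dots> = pdir l (pdir k (pdir j (pdir i f))) 0"
      by (rule 2) (intro sm)
    finally show ?thesis unfolding h4_def .
  qed
  have h3_sym: "h3 k l i = h3 l k i" for k l i
    unfolding h3_def by (rule ddir_cong[OF V]) (rule ddir_swap[OF V(1) f])
  let ?q = "\<lambda>z. \<Sum>k\<in>UNIV. pdir k f z * pdir k f z"
  have sq: "smooth_on ?q V" by (intro sm)
  have q0: "?q 0 = 0" by (simp add: crit)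
  have q1: "pdir i ?q 0 = 0" for i
    by (subst D1) (auto intro!: sm simp: D1 sm V crit)
  have q2: "pdir j (pdir i ?q) 0 = 2 * h2 i j" for i j
  proof -
    have "pdir j (pdir i ?q) 0 = (\<Sum>k\<in>UNIV. pdir j (pdir i (\<lambda>z. pdir k f z * pdir k f z)) 0)"
      by (subst D2) (auto intro!: sm V)
    also have "\<dots> = (\<Sum>k\<in>UNIV. 2 * (h i k * h k j))"
      by (subst ddir2_mult_vanish[OF V(1)]) (auto intro!: sm V crit simp: sym h_app)
    finally show ?thesis by (simp add: h2_def sum_distrib_left)
  qed
  let ?E = "\<lambda>z. \<theta> z * \<theta> z"
  let ?N = "\<lambda>z. ?E z * (1 + ?q z)"
  have sE: "smooth_on ?E V" and s1: "smooth_on (\<lambda>z. 1 + ?q z) V" by (intro sm)+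
  have r1: "pdir i (\<lambda>z. 1 + ?q z) 0 = 0" for i
    using ddir_add_on[OF V(1) smooth_on_const sq V(2)] q1 by simp
  have r2: "pdir j (pdir i (\<lambda>z. 1 + ?q z)) 0 = 2 * h2 i j" for i j
    using ddir2_add_on[OF V(1) smooth_on_const sq V(2)] q2 by simp
  \<comment> \<open>The normalisation \<open>norm\<close> is a constant function, which determines
    the first and second derivatives of \<open>\<theta>\<close> at 0.\<close>
  have N1: "pdir i ?N 0 = 0" for i
    using ddir_cong[OF V norm, where v = "axis i 1"] by simp
  have N2: "pdir j (pdir i ?N) 0 = 0" for i j
    using ddir_cong[OF V ddir_cong[OF V(1) _ norm, where v = "axis i 1"], where v = "axis j 1"] by simp
  have \<theta>d: "pdir i \<theta> 0 = 0" for i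
    using N1[of i] ddir_mult_on[OF V(1) sE s1 V(2)] ddir_mult_on[OF V(1) \<theta> \<theta> V(2)] r1 q0 \<theta>1 by simp
  have \<theta>dd: "pdir j (pdir i \<theta>) 0 = - h2 i j" for i j
    using N2[of j i] ddir2_mult_on[OF V(1) sE s1 V(2)] ddir2_mult_on[OF V(1) \<theta> \<theta> V(2)]
      ddir_mult_on[OF V(1) \<theta> \<theta> V(2)] r1 r2 q0 \<theta>1 \<theta>d by simp
  \<comment> \<open>This is half the derivative of \<open>?q\<close>. Both \<open>pdir k f\<close>
    and \<open>?p l\<close> vanish at 0, so the correction \<open>?c\<close> below vanishes to first
    order and only products of first derivatives survive in \<open>c2\<close>.\<close>
  let ?p = "\<lambda>l z. \<Sum>a\<in>UNIV. pdir a f z * pdir l (pdir a f) z"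
  have sp: "smooth_on (?p l) V" for l by (intro sm)
  have p0: "?p l 0 = 0" for l by (simp add: crit)
  have p1: "pdir i (?p l) 0 = h2 i l" for i l
  proof -
    have "pdir i (?p l) 0 = (\<Sum>a\<in>UNIV. pdir i (\<lambda>z. pdir a f z * pdir l (pdir a f) z) 0)"
      by (rule ddir_sum_on[OF V(1)]) (intro sm V)+
    also have "\<dots> = (\<Sum>a\<in>UNIV. h i a * h a l)"
      by (subst ddir_mult_on[OF V(1)]) (auto intro!: sm V simp: crit sym h_app)
    finally show ?thesis by (simp add: h2_def)
  qed
  let ?c = "\<lambda>k l z. \<theta> z * (\<theta> z * \<theta> z) * (pdir k f z * ?p l z)"
  have sfp: "smooth_on (\<lambda>z. pdir k f z * ?p l z) V" for k l by (intro sm)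
  have sc: "smooth_on (?c k l) V" for k l by (intro sm)
  have s\<theta>3: "smooth_on (\<lambda>z. \<theta> z * (\<theta> z * \<theta> z)) V" by (intro sm)
  have fp1: "pdir i (\<lambda>z. pdir k f z * ?p l z) 0 = 0" for i k l
    using ddir_mult_on[OF V(1) ld[OF f] sp V(2)] crit p0 by simp
  have fp2: "pdir j (pdir i (\<lambda>z. pdir k f z * ?p l z)) 0 = h j k * h2 i l + h i k * h2 j l" for i j k l
    using ddir2_mult_vanish[OF V(1) ld[OF f] sp V(2) crit p0] p1
    by (simp add: h_app sym[of k])
  have c1: "pdir i (?c k l) 0 = 0" for i k l
    using ddir_mult_on[OF V(1) s\<theta>3 sfp V(2)] fp1 crit by simp
  have c2: "pdir j (pdir i (?c k l)) 0 = h j k * h2 i l + h i k * h2 j l" for i j k l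
    using ddir2_mult_on[OF V(1) s\<theta>3 sfp V(2)] fp1 fp2 crit \<theta>1 by simp
  let ?b = "\<lambda>k l z. \<theta> z * pdir l (pdir k f) z"
  have sb: "smooth_on (?b k l) V" for k l by (intro sm)
  have b1: "pdir i (?b k l) 0 = h3 k l i" for i k l
    using ddir_mult_on[OF V(1) \<theta> ld[OF ld[OF f]] V(2)] \<theta>1 \<theta>d by (simp add: h3_def)
  have b2: "pdir j (pdir i (?b k l)) 0 = h4 k l i j - h2 i j * h k l" for i j k l
    using ddir2_mult_on[OF V(1) \<theta> ld[OF ld[OF f]] V(2)] \<theta>1 \<theta>d \<theta>dd by (simp add: h4_def h_def)
  have Beq: "B k l = (\<lambda>z. ?b k l z - ?c k l z)" for k l
    using B by blast
  have sB: "smooth_on (B k l) V" for k l unfolding Beq by (intro smooth_on_diff V(1) sb sc)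
  have B0: "B k l 0 = h k l" for k l by (simp add: Beq crit \<theta>1 h_def)
  have B1: "pdir i (B k l) 0 = h3 k l i" for i k l
    unfolding Beq ddir_diff_on[OF V(1) sb sc V(2)] b1 c1 by simp
  \<comment> \<open>The first cubic term stems from the second derivative of
    \<open>\<theta>\<close>, the other two from the inverse metric.\<close>
  have B2: "pdir j (pdir i (B k l)) 0 = h4 k l i j - h2 i j * h k l - h j k * h2 i l - h i k * h2 j l" for i j k l
    unfolding Beq ddir2_diff_on[OF V(1) sb sc V(2)] b2 c2 by simp
  define S where "S = (\<Sum>i\<in>UNIV. \<Sum>j\<in>UNIV. h i j * h i j)"
  define c where "c = (\<Sum>k\<in>UNIV. h k k)"
  define k3 where "k3 = (\<Sum>i\<in>UNIV. \<Sum>j\<in>UNIV. h i j * h2 i j)"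
  define k4 where "k4 = (\<Sum>i\<in>UNIV. \<Sum>j\<in>UNIV. h2 i j * h2 i j)"
  define Q where "Q = (\<Sum>i\<in>UNIV. \<Sum>j\<in>UNIV. \<Sum>k\<in>UNIV. h i j * h4 k k i j)"
  have c_eq: "c = lam + f 0 / 2"
    using mean[OF V(2)] by (simp add: B0 c_def \<theta>1)
  have S_eq: "S = s"
    using const[OF V(2)] by (simp add: B0 S_def sym)
  \<comment> \<open>The support function \<langle>x, \<xi>\<rangle>: the position has components
    \<open>z\<close> and \<open>f z\<close>, the unit normal has
    \<open>- \<theta> z * pdir k f z\<close> and \<open>\<theta> z\<close>.\<close>
  let ?u = "\<lambda>z. \<theta> z * (f z - (\<Sum>k\<in>UNIV. z $ k * pdir k f z))"
  have u2: "pdir j (pdir i ?u) 0 = - h i j - f 0 * h2 i j" for i j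
  proof -
    let ?w = "\<lambda>z. \<Sum>k\<in>UNIV. z $ k * pdir k f z"
    have ax: "pdir i (\<lambda>z::real^'n. z $ k) 0 = (if i = k then 1 else 0)" for i k :: 'n
    proof -
      have "pdir i (\<lambda>z::real^'n. z $ k) 0 = ddir (axis i 1) (\<lambda>z. z) 0 $ k"
        by (rule ddir_bounded_linear[OF bounded_linear_vec_nth]) simp
      also have "\<dots> = axis i 1 $ k" by (simp add: ddir_def)
      also have "\<dots> = (if i = k then 1 else 0)" by (simp add: axis_def)
      finally show ?thesis .
    qed
    have sw: "smooth_on ?w V" and sfw: "smooth_on (\<lambda>z. f z - ?w z) V" by (intro sm)+
    have w1: "pdir i ?w 0 = 0" for i
    proof -
      have "pdir i ?w 0 = (\<Sum>k\<in>UNIV. pdir i (\<lambda>z. z $ k * pdir k f z) 0)"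
        by (rule ddir_sum_on[OF V(1)]) (intro sm V)+
      then show ?thesis using ddir_mult_on[OF V(1) coord ld[OF f] V(2)] by (simp add: crit)
    qed
    have "pdir j (pdir i ?w) 0 = (\<Sum>k\<in>UNIV. pdir j (pdir i (\<lambda>z. z $ k * pdir k f z)) 0)"
      by (rule ddir2_sum_on[OF V(1)]) (intro sm V)+
    also have "\<dots> = (\<Sum>k\<in>UNIV. (if j = k then 1 else 0) * h k i + (if i = k then 1 else 0) * h k j)"
      using ddir2_mult_vanish[OF V(1) coord ld[OF f] V(2) _ crit] by (simp add: ax h_def)
    also have "\<dots> = 2 * h i j"
      by (simp add: sum.distrib if_distrib[of "\<lambda>x. x * _"] sym cong: if_cong)
    finally have w2: "pdir j (pdir i ?w) 0 = 2 * h i j" .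
    show ?thesis
      using ddir2_mult_on[OF V(1) \<theta> sfw V(2), where v = "axis i 1" and w = "axis j 1"]
      by (simp add: \<theta>1 \<theta>d \<theta>dd ddir2_diff_on[OF V(1) f sw V(2)] w2 h_def)
  qed
  \<comment> \<open>The Hessian of \<open>mean\<close>. After the trace the two mixed cubic terms of
    \<open>B2\<close> coincide, both being an entry of the cube of \<open>h\<close>; this accounts
    for the factor 2.\<close>
  have I: "(\<Sum>k\<in>UNIV. h4 k k i j) = c * h2 i j + 2 * (\<Sum>k\<in>UNIV. h i k * h2 j k)
      - h i j / 2 - f 0 * h2 i j / 2" for i j
  proof -
    have "pdir j (pdir i (\<lambda>z. \<Sum>k\<in>UNIV. B k k z)) 0
        = pdir j (pdir i (\<lambda>z. lam + 1 / 2 * ?u z)) 0"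
      by (rule ddir_cong[OF V]) (rule ddir_cong[OF V(1) _ mean])
    also have "\<dots> = 1 / 2 * pdir j (pdir i ?u) 0"
    proof -
      have su: "smooth_on ?u V" and su2: "smooth_on (\<lambda>z. 1 / 2 * ?u z) V" by (intro sm)+
      show ?thesis
        by (simp only: ddir2_add_on[OF V(1) smooth_on_const su2 V(2)]
            ddir2_cmult_on[OF V(1) su V(2)] ddir_const)
    qed
    also have "pdir j (pdir i (\<lambda>z. \<Sum>k\<in>UNIV. B k k z)) 0 = (\<Sum>k\<in>UNIV. pdir j (pdir i (B k k)) 0)"
      by (rule ddir2_sum_on[OF V(1) sB V(2)])
    finally have "(\<Sum>k\<in>UNIV. h4 k k i j) - h2 i j * c - (\<Sum>k\<in>UNIV. h j k * h2 i k)
        - (\<Sum>k\<in>UNIV. h i k * h2 j k) = 1 / 2 * (- h i j - f 0 * h2 i j)"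
      by (simp add: B2 u2 sum_subtractf c_def sum_distrib_left)
    moreover have "(\<Sum>k\<in>UNIV. h j k * h2 i k) = (\<Sum>k\<in>UNIV. h i k * h2 j k)"
    proof -
      have "(\<Sum>k\<in>UNIV. h j k * h2 i k) = (\<Sum>k\<in>UNIV. \<Sum>a\<in>UNIV. h j k * (h i a * h a k))"
        by (simp add: h2_def sum_distrib_left)
      also have "\<dots> = (\<Sum>a\<in>UNIV. \<Sum>k\<in>UNIV. h j k * (h i a * h a k))" by (rule sum.swap)
      also have "\<dots> = (\<Sum>a\<in>UNIV. h i a * h2 j a)"
        by (simp add: h2_def sum_distrib_left sym mult_ac)
      finally show ?thesis .
    qed
    ultimately show ?thesis by (simp add: field_simps)
  qed
  have k4': "(\<Sum>i\<in>UNIV. \<Sum>j\<in>UNIV. h i j * (\<Sum>k\<in>UNIV. h i k * h2 j k)) = k4"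
  proof -
    have "(\<Sum>i\<in>UNIV. \<Sum>j\<in>UNIV. h i j * (\<Sum>k\<in>UNIV. h i k * h2 j k))
        = (\<Sum>j\<in>UNIV. \<Sum>i\<in>UNIV. \<Sum>k\<in>UNIV. h i j * h i k * h2 j k)"
      by (subst sum.swap) (simp add: sum_distrib_left mult.assoc)
    also have "\<dots> = (\<Sum>j\<in>UNIV. \<Sum>k\<in>UNIV. \<Sum>i\<in>UNIV. h i j * h i k * h2 j k)"
      by (rule sum.cong[OF refl]) (rule sum.swap)
    also have "\<dots> = k4"
      unfolding k4_def by (intro sum.cong refl) (simp add: h2_def[of _ _] sym flip: sum_distrib_right)
    finally show ?thesis .
  qed
  \<comment> \<open>Contraction of \<open>I\<close> with \<open>h\<close>.\<close>
  have Q1: "Q = c * k3 + 2 * k4 - S / 2 - f 0 * k3 / 2"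
  proof -
    have "Q = (\<Sum>i\<in>UNIV. \<Sum>j\<in>UNIV. h i j * (\<Sum>k\<in>UNIV. h4 k k i j))"
      by (simp add: Q_def sum_distrib_left)
    also have "\<dots> = (\<Sum>i\<in>UNIV. \<Sum>j\<in>UNIV. c * (h i j * h2 i j) + 2 * (h i j * (\<Sum>k\<in>UNIV. h i k * h2 j k))
        - (h i j * h i j) / 2 - f 0 / 2 * (h i j * h2 i j))"
      by (intro sum.cong refl) (simp add: I algebra_simps)
    also have "\<dots> = c * k3 + 2 * k4 - S / 2 - f 0 / 2 * k3"
      unfolding S_def k3_def k4'[symmetric]
      by (simp add: sum.distrib sum_subtractf sum_distrib_left sum_divide_distrib)
    finally show ?thesis by simp
  qed
  \<comment> \<open>The Laplacian of \<open>const\<close>. The last sum is |\<nabla>h|^2, since at 0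
    the first derivatives of the metric vanish and covariant derivatives of \<open>h\<close> are
    partial ones.\<close>
  have II: "0 = 2 * (Q - S * S - 2 * k4) + 2 * (\<Sum>i\<in>UNIV. \<Sum>k\<in>UNIV. \<Sum>l\<in>UNIV. (h3 k l i)\<^sup>2)"
  proof -
    have "0 = pdir i (pdir i (\<lambda>z. \<Sum>k\<in>UNIV. \<Sum>l\<in>UNIV. B k l z * B l k z)) 0" for i
      using ddir_cong[OF V ddir_cong[OF V(1) _ const, where v = "axis i 1"], where v = "axis i 1"] by simp
    moreover have "pdir i (pdir i (\<lambda>z. \<Sum>k\<in>UNIV. \<Sum>l\<in>UNIV. B k l z * B l k z)) 0
        = (\<Sum>k\<in>UNIV. \<Sum>l\<in>UNIV. h k l * pdir i (pdir i (B l k)) 0 + pdir i (pdir i (B k l)) 0 * h l k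
            + 2 * (h3 k l i)\<^sup>2)" for i
    proof -
      have "pdir i (pdir i (\<lambda>z. \<Sum>k\<in>UNIV. \<Sum>l\<in>UNIV. B k l z * B l k z)) 0
          = (\<Sum>k\<in>UNIV. \<Sum>l\<in>UNIV. pdir i (pdir i (\<lambda>z. B k l z * B l k z)) 0)"
        by (subst ddir2_sum_on[OF V(1)]; (intro sm sB V)?)
          (subst ddir2_sum_on[OF V(1)]; (intro sm sB V refl)?)
      then show ?thesis
        by (simp add: ddir2_mult_on[OF V(1) sB sB V(2)] B0 B1 h3_sym power2_eq_square algebra_simps)
    qed
    ultimately have "0 = (\<Sum>i\<in>UNIV. \<Sum>k\<in>UNIV. \<Sum>l\<in>UNIV. h k l * pdir i (pdir i (B l k)) 0
        + pdir i (pdir i (B k l)) 0 * h l k + 2 * (h3 k l i)\<^sup>2)" by simp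
    also have "\<dots> = 2 * (\<Sum>i\<in>UNIV. \<Sum>k\<in>UNIV. \<Sum>l\<in>UNIV. h k l * pdir i (pdir i (B k l)) 0)
        + 2 * (\<Sum>i\<in>UNIV. \<Sum>k\<in>UNIV. \<Sum>l\<in>UNIV. (h3 k l i)\<^sup>2)"
    proof -
      have "(\<Sum>k\<in>UNIV. \<Sum>l\<in>UNIV. h k l * pdir i (pdir i (B l k)) 0)
          = (\<Sum>k\<in>UNIV. \<Sum>l\<in>UNIV. h k l * pdir i (pdir i (B k l)) 0)" for i
        by (subst sum.swap) (simp add: sym)
      moreover have "(\<Sum>k\<in>UNIV. \<Sum>l\<in>UNIV. pdir i (pdir i (B k l)) 0 * h l k)
          = (\<Sum>k\<in>UNIV. \<Sum>l\<in>UNIV. h k l * pdir i (pdir i (B k l)) 0)" for i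
        by (simp add: sym mult.commute)
      ultimately show ?thesis by (simp add: sum.distrib sum_distrib_left)
    qed
    \<comment> \<open>By \<open>h4_swap\<close> the contraction of \<open>h\<close> with its
      Laplacian is again \<open>Q\<close>, up to traces of powers of \<open>h\<close>.\<close>
    also have "(\<Sum>i\<in>UNIV. \<Sum>k\<in>UNIV. \<Sum>l\<in>UNIV. h k l * pdir i (pdir i (B k l)) 0) = Q - S * S - 2 * k4"
    proof -
      have tr: "(\<Sum>i\<in>UNIV. \<Sum>k\<in>UNIV. \<Sum>l\<in>UNIV. h2 i i * (h k l * h k l)) = (\<Sum>i\<in>UNIV. h2 i i) * S"
        by (simp only: S_def flip: sum_distrib_left sum_distrib_right)
      have "(\<Sum>i\<in>UNIV. \<Sum>k\<in>UNIV. \<Sum>l\<in>UNIV. h k l * pdir i (pdir i (B k l)) 0)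
          = (\<Sum>i\<in>UNIV. \<Sum>k\<in>UNIV. \<Sum>l\<in>UNIV. h k l * h4 i i k l - h2 i i * (h k l * h k l)
              - 2 * (h k l * h k i * h2 l i))"
        by (intro sum.cong refl) (simp add: B2 h4_swap sym sym2 algebra_simps)
      also have "\<dots> = (\<Sum>i\<in>UNIV. \<Sum>k\<in>UNIV. \<Sum>l\<in>UNIV. h k l * h4 i i k l)
          - (\<Sum>i\<in>UNIV. h2 i i) * S - 2 * (\<Sum>i\<in>UNIV. \<Sum>k\<in>UNIV. \<Sum>l\<in>UNIV. h k l * h k i * h2 l i)"
        by (simp only: sum_subtractf tr sum_distrib_left)
      also have "(\<Sum>i\<in>UNIV. \<Sum>k\<in>UNIV. \<Sum>l\<in>UNIV. h k l * h4 i i k l) = Q"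
        unfolding Q_def
        by (subst sum.swap) (rule sum.cong[OF refl], rule sum.swap)
      also have "(\<Sum>i\<in>UNIV. h2 i i) = S"
        by (simp add: h2_def S_def sym)
      also have "(\<Sum>i\<in>UNIV. \<Sum>k\<in>UNIV. \<Sum>l\<in>UNIV. h k l * h k i * h2 l i) = k4"
      proof -
        have "(\<Sum>i\<in>UNIV. \<Sum>k\<in>UNIV. \<Sum>l\<in>UNIV. h k l * h k i * h2 l i)
            = (\<Sum>k\<in>UNIV. \<Sum>l\<in>UNIV. \<Sum>i\<in>UNIV. h k l * h k i * h2 l i)"
          by (subst sum.swap) (rule sum.cong[OF refl], rule sum.swap)
        then show ?thesis using k4' by (simp add: sum_distrib_left mult.assoc)
      qed
      finally show ?thesis .
    qed
    finally show ?thesis .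
  qed
  define N where "N = (\<Sum>i\<in>UNIV. \<Sum>k\<in>UNIV. \<Sum>l\<in>UNIV. (h3 k l i)\<^sup>2)"
  have "0 \<le> N" unfolding N_def by (intro sum_nonneg) auto
  then have "Q \<le> S * S + 2 * k4" using II[folded N_def] by (auto simp: right_diff_distrib)
  \<comment> \<open>Inserting \<open>Q1\<close> cancels \<open>k4\<close>, and \<open>c_eq\<close>
    replaces \<open>c - f 0 / 2\<close> by \<open>lam\<close>.\<close>
  then have "lam * k3 \<le> S\<^sup>2 + S / 2"
    using Q1 c_eq by (simp add: power2_eq_square algebra_simps)
  then show "lam * (\<Sum>i\<in>UNIV. \<Sum>j\<in>UNIV. h i j * (\<Sum>a\<in>UNIV. h i a * h a j))
    \<le> (\<Sum>i\<in>UNIV. \<Sum>j\<in>UNIV. h i j * h i j)\<^sup>2 + (\<Sum>i\<in>UNIV. \<Sum>j\<in>UNIV. h i j * h i j) / 2"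
    unfolding k3_def h2_def S_def .
  show "(\<Sum>k\<in>UNIV. h k k) = lam + f 0 / 2" using c_eq c_def by simp
  show "(\<Sum>i\<in>UNIV. \<Sum>j\<in>UNIV. h i j * h i j) = s" using S_eq S_def by simp
qed

section \<open>Linear algebra\<close>

text \<open>With k_i the trace of the i-th power, positivity of \<kappa> gives k_2^2 \<le> k_1 k_3,
  so the hypothesis leaves k_3 \<le> k_2. But \<kappa> \<ge> I bounds each summand of k_3 - k_2
  below by twice the squared distance from \<open>\<kappa> (e i)\<close> to \<open>e i\<close>. No
  diagonalisation is involved.\<close>

lemma operator_rigidity:
  fixes \<kappa> :: "real ^ 'n::finite \<Rightarrow> real ^ 'n"
  assumes lin: "linear \<kappa>" and adj: "\<And>v w. \<kappa> v \<bullet> w = v \<bullet> \<kappa> w"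
    and ge: "\<And>v. v \<bullet> v \<le> v \<bullet> \<kappa> v" and c: "c > 0"
  defines "e \<equiv> \<lambda>i. axis i (1::real)"
  assumes le: "((\<Sum>i\<in>UNIV. e i \<bullet> \<kappa> (e i)) + c) * (\<Sum>i\<in>UNIV. \<kappa> (e i) \<bullet> \<kappa> (\<kappa> (e i)))
      \<le> (\<Sum>i\<in>UNIV. \<kappa> (e i) \<bullet> \<kappa> (e i))\<^sup>2 + c * (\<Sum>i\<in>UNIV. \<kappa> (e i) \<bullet> \<kappa> (e i))"
  shows "\<kappa> (e i) = e i"
proof -
  let ?k1 = "\<Sum>i\<in>UNIV. e i \<bullet> \<kappa> (e i)" and ?k2 = "\<Sum>i\<in>UNIV. \<kappa> (e i) \<bullet> \<kappa> (e i)"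
    and ?k3 = "\<Sum>i\<in>UNIV. \<kappa> (e i) \<bullet> \<kappa> (\<kappa> (e i))"
  have pos: "0 \<le> v \<bullet> \<kappa> v" for v using ge[of v] inner_ge_zero[of v] by linarith
  have "(\<Sum>i\<in>(UNIV::'n set). 1) \<le> ?k1"
    by (rule sum_mono) (use ge[of "e _"] in \<open>simp add: e_def inner_axis_axis\<close>)
  then have k1: "?k1 > 0" by (simp add: card_gt_0_iff less_le_trans[of 0 "real CARD('n)"])
  have q: "0 \<le> (\<Sum>i\<in>UNIV. (\<kappa> (e i) - s *\<^sub>R e i) \<bullet> \<kappa> (\<kappa> (e i) - s *\<^sub>R e i))" for s
    by (intro sum_nonneg pos)
  have "(\<kappa> (e i) - s *\<^sub>R e i) \<bullet> \<kappa> (\<kappa> (e i) - s *\<^sub>R e i)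
      = \<kappa> (e i) \<bullet> \<kappa> (\<kappa> (e i)) - 2 * s * (\<kappa> (e i) \<bullet> \<kappa> (e i)) + s\<^sup>2 * (e i \<bullet> \<kappa> (e i))" for s i
    using adj[of "e i" "\<kappa> (e i)"] adj[of "e i" "e i"]
    by (simp add: linear_diff[OF lin] linear_cmul[OF lin] inner_diff_left inner_diff_right
        power2_eq_square algebra_simps)
  then have "(\<Sum>i\<in>UNIV. (\<kappa> (e i) - s *\<^sub>R e i) \<bullet> \<kappa> (\<kappa> (e i) - s *\<^sub>R e i))
      = (\<Sum>i\<in>UNIV. \<kappa> (e i) \<bullet> \<kappa> (\<kappa> (e i)) - 2 * s * (\<kappa> (e i) \<bullet> \<kappa> (e i)) + s\<^sup>2 * (e i \<bullet> \<kappa> (e i)))" for s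
    by (rule sum.cong[OF refl])
  then have r: "(\<Sum>i\<in>UNIV. (\<kappa> (e i) - s *\<^sub>R e i) \<bullet> \<kappa> (\<kappa> (e i) - s *\<^sub>R e i))
      = ?k3 - 2 * s * ?k2 + s\<^sup>2 * ?k1" for s
    unfolding sum.distrib sum_subtractf sum_distrib_left[symmetric] .
  have "0 \<le> ?k3 - 2 * s * ?k2 + s\<^sup>2 * ?k1" for s using q[of s] unfolding r .
  \<comment> \<open>The minimiser in \<open>s\<close> of the quadratic, which is the trace of
    \<kappa> (\<kappa> - s)^2.\<close>
  from this[of "?k2 / ?k1"] have "0 \<le> ?k3 - ?k2\<^sup>2 / ?k1"
    using k1 by (simp add: power2_eq_square)
  then have "?k2\<^sup>2 \<le> ?k1 * ?k3" using k1 by (simp add: field_simps)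
  with le have "c * (?k3 - ?k2) \<le> 0" by (simp add: algebra_simps)
  then have "?k3 - ?k2 \<le> 0" using c by (simp add: mult_le_0_iff)
  moreover have "?k3 - ?k2 = (\<Sum>i\<in>UNIV. \<kappa> (e i) \<bullet> \<kappa> (\<kappa> (e i)) - \<kappa> (e i) \<bullet> \<kappa> (e i))"
    by (simp add: sum_subtractf)
  moreover have "2 * (norm (\<kappa> (e i) - e i))\<^sup>2 \<le> \<kappa> (e i) \<bullet> \<kappa> (\<kappa> (e i)) - \<kappa> (e i) \<bullet> \<kappa> (e i)" for i
  proof -
    \<comment> \<open>The difference of the two products is \<langle>e + b, \<kappa> b\<rangle>.
      Moving \<kappa> to \<open>e\<close> in the first half gives at least |b|^2, and \<kappa> \<ge>
      I gives |b|^2 for the second.\<close>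
    define b where "b = \<kappa> (e i) - e i"
    have \<kappa>e: "\<kappa> (e i) = e i + b" by (simp add: b_def)
    have "e i \<bullet> \<kappa> b = e i \<bullet> b + b \<bullet> b"
      using adj[of "e i" b] by (simp add: \<kappa>e inner_add_left)
    moreover have "0 \<le> e i \<bullet> b" using ge[of "e i"] by (simp add: \<kappa>e inner_add_right)
    moreover have "\<kappa> (e i) \<bullet> \<kappa> (\<kappa> (e i)) - \<kappa> (e i) \<bullet> \<kappa> (e i) = e i \<bullet> \<kappa> b + b \<bullet> \<kappa> b"
      by (simp add: \<kappa>e linear_add[OF lin] inner_add_left inner_add_right)
    ultimately show ?thesis using ge[of b] by (simp add: power2_norm_eq_inner flip: b_def)
  qed
  ultimately have "(\<Sum>i\<in>UNIV. 2 * (norm (\<kappa> (e i) - e i))\<^sup>2) \<le> 0"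
    by (metis (no_types, lifting) order_trans sum_mono)
  then have "2 * (norm (\<kappa> (e i) - e i))\<^sup>2 \<le> 0"
    by (meson member_le_sum finite UNIV_I order_trans zero_le_power2 mult_nonneg_nonneg zero_le_numeral)
  then show ?thesis by simp
qed

text \<open>The same rigidity in matrix entries, the form in which the Simons inequality supplies
  its hypothesis.\<close>

lemma symmetric_rigidity:
  fixes K :: "'n::finite \<Rightarrow> 'n \<Rightarrow> real"
  assumes sym: "\<And>i j. K i j = K j i" and c: "c > 0"
    and ge: "\<And>v :: real ^ 'n. v \<bullet> v \<le> (\<Sum>i\<in>UNIV. \<Sum>j\<in>UNIV. v $ i * v $ j * K i j)"
    and le: "((\<Sum>i\<in>UNIV. K i i) + c) * (\<Sum>i\<in>UNIV. \<Sum>j\<in>UNIV. K i j * (\<Sum>a\<in>UNIV. K i a * K a j))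
      \<le> (\<Sum>i\<in>UNIV. \<Sum>j\<in>UNIV. K i j * K i j)\<^sup>2 + c * (\<Sum>i\<in>UNIV. \<Sum>j\<in>UNIV. K i j * K i j)"
  shows "K i j = (if i = j then 1 else 0)"
proof -
  define \<kappa> :: "real ^ 'n \<Rightarrow> real ^ 'n" where "\<kappa> v = (\<chi> i. \<Sum>j\<in>UNIV. K i j * v $ j)" for v
  have inner: "v \<bullet> \<kappa> w = (\<Sum>i\<in>UNIV. \<Sum>j\<in>UNIV. v $ i * w $ j * K i j)" for v w
    by (simp add: \<kappa>_def inner_vec_def sum_distrib_left mult_ac)
  have lin: "linear \<kappa>"
    by (rule linearI) (simp_all add: \<kappa>_def vec_eq_iff algebra_simps sum.distrib sum_distrib_left)
  have adj: "\<kappa> v \<bullet> w = v \<bullet> \<kappa> w" for v w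
    unfolding inner inner_commute[of "\<kappa> v"]
    by (subst sum.swap) (simp add: sym mult_ac)
  have \<kappa>e: "\<kappa> (axis i 1) = (\<chi> j. K i j)" for i
    by (simp add: \<kappa>_def axis_def if_distrib sym cong: if_cong)
  have 1: "axis i 1 \<bullet> \<kappa> (axis i 1) = K i i" for i
    by (simp add: \<kappa>e inner_axis')
  have 2: "\<kappa> (axis i 1) \<bullet> \<kappa> (axis i 1) = (\<Sum>j\<in>UNIV. K i j * K i j)" for i
    by (simp add: \<kappa>e inner_vec_def)
  have 3: "\<kappa> (axis i 1) \<bullet> \<kappa> (\<kappa> (axis i 1)) = (\<Sum>j\<in>UNIV. K i j * (\<Sum>a\<in>UNIV. K i a * K a j))" for i
    by (simp add: \<kappa>_def[of "\<kappa> _"] inner_vec_def) (simp add: \<kappa>e mult.commute sym)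
  have "\<kappa> (axis i 1) = axis i 1"
    by (rule operator_rigidity[OF lin adj _ c]) (use ge le in \<open>simp_all add: inner 1 2 3 flip: inner\<close>)
  then have "(\<chi> j. K i j) $ j = axis i 1 $ j" by (simp add: \<kappa>e)
  then show ?thesis by (simp add: axis_def)
qed

text \<open>The rows of \<open>W\<close> are an orthonormal frame in graph coordinates, \<open>p\<close> and \<open>F\<close> the gradient and
  the Hessian of the graph function, and \<open>- t p\<close> is the horizontal part of the unit normal.\<close>

lemma frame_sums_graph:
  fixes W F :: "real ^ 'n::finite ^ 'n" and p :: "'n \<Rightarrow> real"
  assumes W: "\<And>k l. (\<Sum>i\<in>UNIV. W $ i $ k * W $ i $ l) = (if k = l then 1 else 0) - (t * p k) * (t * p l)"
    and F: "\<And>k l. F $ k $ l = F $ l $ k"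
    and h: "\<And>i j. h i j = t * (\<Sum>k\<in>UNIV. \<Sum>l\<in>UNIV. W $ i $ k * W $ j $ l * F $ k $ l)"
    and B: "\<And>k l. B k l = t * F $ k $ l - t * (t * t) * (p k * (\<Sum>a\<in>UNIV. p a * F $ a $ l))"
  shows "(\<Sum>i\<in>UNIV. h i i) = (\<Sum>k\<in>UNIV. B k k)"
    and "(\<Sum>i\<in>UNIV. \<Sum>j\<in>UNIV. (h i j)\<^sup>2) = (\<Sum>k\<in>UNIV. \<Sum>l\<in>UNIV. B k l * B l k)"
proof -
  \<comment> \<open>\<open>G\<close> is the inverse metric. The frame matrix W F W^T and the
    coordinate matrix W^T W F have the same trace, and so have their squares, by cyclicity.\<close>
  define G :: "real ^ 'n ^ 'n" where "G = transpose W ** W"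
  have G: "G $ k $ l = (if k = l then 1 else 0) - (t * p k) * (t * p l)" for k l
    using W by (simp add: G_def matrix_matrix_mult_def transpose_def)
  define Hm where "Hm = W ** (F ** transpose W)"
  have Hm: "h i j = t * Hm $ i $ j" for i j
    unfolding h Hm_def
    by (simp add: matrix_matrix_mult_def transpose_def sum_distrib_left mult_ac)
  define Bm where "Bm = G ** F"
  have Bm: "B k l = t * Bm $ k $ l" for k l
  proof -
    have "Bm $ k $ l = (\<Sum>a\<in>UNIV. (if k = a then F $ a $ l else 0) - t * p k * (t * p a) * F $ a $ l)"
      by (auto simp: Bm_def matrix_matrix_mult_def G left_diff_distrib intro!: sum.cong)
    also have "\<dots> = F $ k $ l - t * t * p k * (\<Sum>a\<in>UNIV. p a * F $ a $ l)"
      by (simp add: sum_subtractf sum_distrib_left mult_ac)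
    finally have Bm: "Bm $ k $ l = F $ k $ l - t * t * p k * (\<Sum>a\<in>UNIV. p a * F $ a $ l)" .
    show ?thesis unfolding B Bm by (simp add: algebra_simps)
  qed
  have tr: "trace Hm = trace Bm"
    unfolding Hm_def Bm_def G_def
    by (metis matrix_mul_assoc trace_mul_sym)
  have tr2: "trace (Hm ** Hm) = trace (Bm ** Bm)"
  proof -
    have "trace (Hm ** Hm) = trace (W ** (F ** transpose W ** W ** F ** transpose W))"
      by (simp add: Hm_def matrix_mul_assoc)
    also have "\<dots> = trace ((F ** transpose W ** W ** F ** transpose W) ** W)"
      by (rule trace_mul_sym)
    also have "\<dots> = trace (F ** (G ** F ** G))" by (simp add: G_def matrix_mul_assoc)
    also have "\<dots> = trace (G ** F ** G ** F)" by (rule trace_mul_sym)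
    finally show ?thesis by (simp add: Bm_def matrix_mul_assoc)
  qed
  have hsym: "h i j = h j i" for i j
    unfolding h by (subst (2) sum.swap) (simp add: F mult_ac)
  show "(\<Sum>i\<in>UNIV. h i i) = (\<Sum>k\<in>UNIV. B k k)"
    using tr by (simp add: Hm Bm trace_def flip: sum_distrib_left)
  have "(\<Sum>i\<in>UNIV. \<Sum>j\<in>UNIV. (h i j)\<^sup>2) = (\<Sum>i\<in>UNIV. \<Sum>j\<in>UNIV. h i j * h j i)"
    by (intro sum.cong refl) (simp add: power2_eq_square hsym)
  also have "\<dots> = t * t * trace (Hm ** Hm)"
    by (simp add: Hm trace_def matrix_matrix_mult_def sum_distrib_left mult_ac)
  also have "\<dots> = (\<Sum>k\<in>UNIV. \<Sum>l\<in>UNIV. B k l * B l k)"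
    unfolding tr2 by (simp add: Bm trace_def matrix_matrix_mult_def sum_distrib_left mult_ac)
  finally show "(\<Sum>i\<in>UNIV. \<Sum>j\<in>UNIV. (h i j)\<^sup>2) = (\<Sum>k\<in>UNIV. \<Sum>l\<in>UNIV. B k l * B l k)" .
qed

text \<open>An orthonormal set of full cardinality is a basis. Frame and normal are arbitrary
  because this is applied both to the fixed frame at a base point and to moving frames
  nearby.\<close>

lemma orthonormal_hyperplane_expand:
  fixes d :: "'n::finite \<Rightarrow> 'b::euclidean_space"
  assumes dim: "DIM('b) = CARD('n) + 1"
    and d: "\<And>i j. d i \<bullet> d j = (if i = j then 1 else 0)"
    and \<nu>: "\<And>i. d i \<bullet> \<nu> = 0" "\<nu> \<bullet> \<nu> = 1"
  shows "w = (\<Sum>i\<in>UNIV. (w \<bullet> d i) *\<^sub>R d i) + (w \<bullet> \<nu>) *\<^sub>R \<nu>"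
    and "w \<bullet> w' = (\<Sum>i\<in>UNIV. (w \<bullet> d i) * (w' \<bullet> d i)) + (w \<bullet> \<nu>) * (w' \<bullet> \<nu>)"
proof -
  let ?B = "insert \<nu> (range d)"
  have inj: "inj d" by (rule injI) (metis d zero_neq_one)
  have \<nu>d: "\<nu> \<notin> range d" using \<nu> by (metis rangeE zero_neq_one)
  have orth: "pairwise orthogonal ?B"
    using d \<nu> by (auto simp: pairwise_def orthogonal_def inner_commute)
  have n1: "norm b = 1" if "b \<in> ?B" for b using that d \<nu> by (auto simp: norm_eq_1)
  have "independent ?B"
    by (rule pairwise_orthogonal_independent[OF orth]) (use n1[of 0] in auto)
  moreover have "card ?B = DIM('b)"
    using \<nu>d inj dim by (simp add: card_image)
  ultimately have "UNIV \<subseteq> span ?B" by (intro card_ge_dim_independent) auto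
  then have "(\<Sum>b\<in>?B. (w \<bullet> b) *\<^sub>R b) = w" for w
    by (intro orthonormal_basis_expand orth n1) auto
  then have e: "w = (\<Sum>i\<in>UNIV. (w \<bullet> d i) *\<^sub>R d i) + (w \<bullet> \<nu>) *\<^sub>R \<nu>" for w
    using \<nu>d by (simp add: sum.reindex[OF inj] add.commute)
  show "w = (\<Sum>i\<in>UNIV. (w \<bullet> d i) *\<^sub>R d i) + (w \<bullet> \<nu>) *\<^sub>R \<nu>" by (rule e)
  have "w \<bullet> w' = ((\<Sum>i\<in>UNIV. (w \<bullet> d i) *\<^sub>R d i) + (w \<bullet> \<nu>) *\<^sub>R \<nu>) \<bullet> w'" using e[of w] by simp
  then have "w \<bullet> w' = (\<Sum>i\<in>UNIV. (w \<bullet> d i) * (d i \<bullet> w')) + (w \<bullet> \<nu>) * (\<nu> \<bullet> w')"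
    by (simp only: inner_add_left inner_sum_left inner_scaleR_left)
  then show "w \<bullet> w' = (\<Sum>i\<in>UNIV. (w \<bullet> d i) * (w' \<bullet> d i)) + (w \<bullet> \<nu>) * (w' \<bullet> \<nu>)"
    by (simp only: inner_commute[of w'])
qed

section \<open>Hypersurfaces as graphs over a tangent hyperplane\<close>

text \<open>The shape operator matrix \<open>B\<close> of \<open>graph_simons_inequality\<close>. It
  need not be symmetric, so S is the trace of its square and not the sum of its squared
  entries.\<close>

definition graph_shape ::
  "(real ^ 'n::finite \<Rightarrow> real) \<Rightarrow> (real ^ 'n \<Rightarrow> real) \<Rightarrow> 'n \<Rightarrow> 'n \<Rightarrow> real ^ 'n \<Rightarrow> real" where
  "graph_shape f \<theta> k l z = \<theta> z * pdir l (pdir k f) z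
     - \<theta> z * (\<theta> z * \<theta> z) * (pdir k f z * (\<Sum>a\<in>UNIV. pdir a f z * pdir l (pdir a f) z))"

locale immersed_hypersurface =
  fixes M :: "'a topology" and A :: "('a, 'n::finite) chart set"
    and x \<xi> :: "'a \<Rightarrow> real ^ 'm::finite"
  assumes dim: "CARD('m) = CARD('n) + 1"
    and manifold: "smooth_manifold M A"
    and immersion: "smooth_immersion A x"
    and normal: "unit_normal_field A x \<xi>"
begin

lemma atlas: "smooth_atlas M A" using manifold by (simp add: smooth_manifold_def)

lemma smooth_x: "smooth_map A x" using immersion by (simp add: smooth_immersion_def)

lemma smooth_\<xi>: "smooth_map A \<xi>" using normal by (simp add: unit_normal_field_def)

lemma chart_at:
  assumes "p \<in> topspace M" obtains c where "c \<in> A" "p \<in> fst c"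
  using assms atlas unfolding smooth_atlas_def by blast

lemma frame_at:
  assumes "c \<in> A" "p \<in> fst c" obtains e where "orthonormal_frame x c p e"
proof -
  have "inj (differential c x p)" using immersion assms by (simp add: smooth_immersion_def)
  from orthonormal_frame_exists[OF linear_differential[OF atlas smooth_x assms] this] that
  show thesis by blast
qed

lemma norm_\<xi>: "p \<in> topspace M \<Longrightarrow> norm (\<xi> p) = 1"
  using chart_at normal unfolding unit_normal_field_def by metis

text \<open>Cauchy-Schwarz against the all-ones vector bounds the squared trace by n times the
  diagonal part of S.\<close>

lemma mean_curvature_sq_le:
  assumes "p \<in> topspace M"
  shows "(mean_curvature A x \<xi> p)\<^sup>2 \<le> real CARD('n) * sff_norm_sq A x \<xi> p"
proof -
  obtain c e where c: "c \<in> A" "p \<in> fst c" and e: "orthonormal_frame x c p e"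
    using chart_at frame_at assms by metis
  let ?h = "\<lambda>i j. second_fundamental_form x \<xi> c p (e i) (e j)"
  have "(\<Sum>i\<in>UNIV. 1 * ?h i i)\<^sup>2 \<le> (\<Sum>i\<in>(UNIV::'n set). 1\<^sup>2) * (\<Sum>i\<in>UNIV. (?h i i)\<^sup>2)"
    by (rule Cauchy_Schwarz_ineq_sum)
  also have "\<dots> \<le> real CARD('n) * (\<Sum>i\<in>UNIV. \<Sum>j\<in>UNIV. (?h i j)\<^sup>2)"
    by (auto intro!: mult_left_mono sum_mono member_le_sum)
  finally show ?thesis
    using mean_curvature_eq[OF atlas immersion normal c e] sff_norm_sq_eq[OF atlas immersion normal c e]
    by simp
qed

text \<open>The projection of \<open>x\<close> to the tangent hyperplane at \<open>p\<close> is a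
  local diffeomorphism, so its inverse \<open>G\<close> parametrises \<open>M\<close> near
  \<open>p\<close> as a graph over that hyperplane. The height \<open>f\<close> and the function
  \<open>\<theta>\<close> are the components of \<open>x\<close> and \<xi> along
  \<open>\<xi> p\<close>.\<close>

lemma graph_chart:
  assumes p: "p \<in> topspace M"
  obtains V :: "(real ^ 'n) set" and zp G f \<theta> and d :: "'n \<Rightarrow> real ^ 'm"
  where "open V" "zp \<in> V" "G zp = p" "\<And>z. z \<in> V \<Longrightarrow> G z \<in> topspace M"
    and "\<And>i j. d i \<bullet> d j = (if i = j then 1 else 0)" "\<And>i. d i \<bullet> \<xi> p = 0"
    and "smooth_on f V" "smooth_on \<theta> V" "\<theta> zp = 1" "\<And>k. pdir k f zp = 0"
    and "\<And>z. z \<in> V \<Longrightarrow> \<theta> z * \<theta> z * (1 + (\<Sum>k\<in>UNIV. pdir k f z * pdir k f z)) = 1"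
    and "\<And>z. z \<in> V \<Longrightarrow> x (G z) = (\<Sum>i\<in>UNIV. (z $ i) *\<^sub>R d i) + f z *\<^sub>R \<xi> p"
    and "\<And>z. z \<in> V \<Longrightarrow> x (G z) \<bullet> \<xi> (G z) = \<theta> z * (f z - (\<Sum>k\<in>UNIV. z $ k * pdir k f z))"
    and "\<And>z. z \<in> V \<Longrightarrow> mean_curvature A x \<xi> (G z) = (\<Sum>k\<in>UNIV. graph_shape f \<theta> k k z)"
    and "\<And>z. z \<in> V \<Longrightarrow> sff_norm_sq A x \<xi> (G z)
      = (\<Sum>k\<in>UNIV. \<Sum>l\<in>UNIV. graph_shape f \<theta> k l z * graph_shape f \<theta> l k z)"
proof -
  obtain c where c: "c \<in> A" "p \<in> fst c" using chart_at p by metis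
  define U where "U = snd c ` fst c"
  define P where "P = inv_into (fst c) (snd c)"
  define y0 where "y0 = snd c p"
  let ?X = "local_rep c x" and ?N = "local_rep c \<xi>"
  have chart: "is_chart M c" using atlas c by (auto simp: smooth_atlas_def)
  then have inj: "inj_on (snd c) (fst c)" using chart_inj by blast
  have oU: "open U" using chart by (auto simp: U_def is_chart_def case_prod_beta)
  have sub: "fst c \<subseteq> topspace M" using atlas c by (auto simp: smooth_atlas_def)
  have y0: "y0 \<in> U" "P y0 = p" using c inj by (auto simp: y0_def U_def P_def)
  have P: "P y \<in> fst c" "snd c (P y) = y" if "y \<in> U" for y
    using that by (auto simp: U_def P_def inv_into_into f_inv_into_f)
  have XP: "?X y = x (P y)" "?N y = \<xi> (P y)" for y by (auto simp: local_rep_def P_def)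
  have sX: "smooth_on ?X U" and sN: "smooth_on ?N U"
    using smooth_x smooth_\<xi> c by (auto simp: smooth_map_def U_def)
  note dX = smooth_on_differentiable[OF sX oU] and dN = smooth_on_differentiable[OF sN oU]
  have diff: "differential c x (P y) v = ddir v ?X y" "differential c \<xi> (P y) v = ddir v ?N y"
    if "y \<in> U" for y v
    using P[OF that] by (auto simp: differential_def ddir_def)
  have perp: "ddir v ?X y \<bullet> ?N y = 0" and unit: "?N y \<bullet> ?N y = 1" if "y \<in> U" for y v
    using normal c(1) P(1)[OF that] diff[OF that] XP unfolding unit_normal_field_def norm_eq_1
    by metis+
  obtain e where e: "orthonormal_frame x c p e" using frame_at c by metis
  define d where "d i = ddir (e i) ?X y0" for i
  let ?\<nu> = "\<xi> p"
  have d: "d i \<bullet> d j = (if i = j then 1 else 0)" for i j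
    using e diff[OF y0(1)] y0(2) by (auto simp: orthonormal_frame_def first_fundamental_form_def d_def)
  have N0: "?N y0 = ?\<nu>" using XP y0(2) by simp
  have d\<nu>: "d i \<bullet> ?\<nu> = 0" for i
    using perp[OF y0(1)] N0 by (simp add: d_def)
  have \<nu>: "?\<nu> \<bullet> ?\<nu> = 1" using unit[OF y0(1)] N0 by simp
  have DIM: "DIM(real ^ 'm) = CARD('n) + 1" using dim by simp
  note expand = orthonormal_hyperplane_expand[OF DIM d d\<nu> \<nu>]
  \<comment> \<open>It is applied to \<open>x\<close> itself and not to its displacement from
    \<open>x p\<close>. So \<open>p\<close> sits at \<open>zp\<close>, in general not 0, and the
    formula for \<langle>x, \<xi>\<rangle> has no constants.\<close>
  define L :: "real ^ 'm \<Rightarrow> real ^ 'n" where "L w = (\<chi> i. w \<bullet> d i)" for w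
  have L: "bounded_linear L"
    unfolding linear_conv_bounded_linear[symmetric] L_def
    by (rule linearI) (simp_all add: vec_eq_iff inner_add_left)
  define F where "F = (\<lambda>y. L (?X y))"
  have sF: "smooth_on F U" unfolding F_def by (rule smooth_on_bounded_linear[OF oU L sX])
  have ddF: "ddir v F y = L (ddir v ?X y)" if "y \<in> U" for y v
    unfolding F_def by (rule ddir_bounded_linear[OF L dX[OF that]])
  have "inj (\<lambda>v. ddir v F y0)"
  proof (rule linear_surjective_imp_injective)
    show lin: "linear (\<lambda>v. ddir v F y0)"
      using linear_ddir smooth_on_differentiable[OF sF oU y0(1)] by blast
    show "surj (\<lambda>v. ddir v F y0)"
    proof (rule surjI)
      fix a :: "real ^ 'n"
      interpret X0: linear "\<lambda>v. ddir v ?X y0" using linear_ddir dX y0(1) by blast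
      have "ddir (\<Sum>i\<in>UNIV. (a $ i) *\<^sub>R e i) F y0 = L (\<Sum>i\<in>UNIV. (a $ i) *\<^sub>R d i)"
        by (simp add: ddF[OF y0(1)] X0.sum X0.scaleR d_def)
      also have "\<dots> = a"
        by (simp add: L_def vec_eq_iff inner_sum_left d if_distrib cong: if_cong)
      finally show "ddir (\<Sum>i\<in>UNIV. (a $ i) *\<^sub>R e i) F y0 = a" .
    qed
  qed simp
  then obtain U' V g where UV: "open U'" "U' \<subseteq> U" "y0 \<in> U'" "open V" "F y0 \<in> V"
      and hom: "homeomorphism U' V F g" and sg: "smooth_on g V"
      and bij: "\<And>z. z \<in> V \<Longrightarrow> bij (\<lambda>v. ddir v g z)"
    using smooth_inverse_function[OF oU sF y0(1)] by metis
  have gU: "g z \<in> U" and Fg: "F (g z) = z" if "z \<in> V" for z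
    using that hom UV(2) by (auto simp: homeomorphism_def)
  have gF: "g (F y0) = y0" using hom UV(3) by (auto simp: homeomorphism_def)
  note dg = smooth_on_differentiable[OF sg UV(4)]
  define X where "X = (\<lambda>z. ?X (g z))"
  define N where "N = (\<lambda>z. ?N (g z))"
  have X: "smooth_on X V" and N: "smooth_on N V"
    unfolding X_def N_def using smooth_on_compose[OF UV(4) oU gU _ sg] sX sN by blast+
  note dX' = smooth_on_differentiable[OF X UV(4)] and dN' = smooth_on_differentiable[OF N UV(4)]
    and ddX' = smooth_on_differentiable[OF smooth_on_ddir[OF X] UV(4)]
  have chX: "ddir v X z = ddir (ddir v g z) ?X (g z)" if "z \<in> V" for v z
    unfolding X_def using ddir_compose dg that dX gU by blast
  have chN: "ddir v N z = ddir (ddir v g z) ?N (g z)" if "z \<in> V" for v z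
    unfolding N_def using ddir_compose dg that dN gU by blast
  have perp': "ddir v X z \<bullet> N z = 0" if "z \<in> V" for v z
    using perp gU that chX by (simp add: N_def)
  have unit': "N z \<bullet> N z = 1" if "z \<in> V" for z
    using unit gU that by (simp add: N_def)
  define f where "f = (\<lambda>z. X z \<bullet> ?\<nu>)"
  define \<theta> where "\<theta> = (\<lambda>z. N z \<bullet> ?\<nu>)"
  have fz: "X z \<bullet> ?\<nu> = f z" and \<theta>z: "N z \<bullet> ?\<nu> = \<theta> z" for z
    by (simp_all add: f_def \<theta>_def)
  have f: "smooth_on f V" and \<theta>: "smooth_on \<theta> V"
    unfolding f_def \<theta>_def by (intro smooth_on_bounded_linear[OF UV(4) bounded_linear_inner_left] X N)+
  have Xd: "X z \<bullet> d i = z $ i" if "z \<in> V" for z i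
    using Fg[OF that] by (auto simp: F_def L_def X_def vec_eq_iff)
  have DXd: "ddir v X z \<bullet> d i = v $ i" if "z \<in> V" for v z i
  proof -
    have "ddir v X z \<bullet> d i = ddir v (\<lambda>z. X z \<bullet> d i) z"
      by (rule ddir_bounded_linear[OF bounded_linear_inner_left dX'[OF that], symmetric])
    also have "\<dots> = ddir v (\<lambda>z. z $ i) z" by (rule ddir_cong[OF UV(4) that Xd])
    also have "\<dots> = ddir v (\<lambda>z. z) z $ i"
      by (rule ddir_bounded_linear[OF bounded_linear_vec_nth]) simp
    finally show ?thesis by (simp add: ddir_def)
  qed
  have DX\<nu>: "ddir v X z \<bullet> ?\<nu> = ddir v f z" if "z \<in> V" for v z
    unfolding f_def by (rule ddir_bounded_linear[OF bounded_linear_inner_left dX'[OF that], symmetric])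
  have DDXd: "ddir w (ddir v X) z \<bullet> d i = 0" if "z \<in> V" for v w z i
  proof -
    have "ddir w (ddir v X) z \<bullet> d i = ddir w (\<lambda>z. ddir v X z \<bullet> d i) z"
      by (rule ddir_bounded_linear[OF bounded_linear_inner_left ddX'[OF that], symmetric])
    also have "\<dots> = ddir w (\<lambda>z. v $ i) z" by (rule ddir_cong[OF UV(4) that DXd])
    finally show ?thesis by simp
  qed
  have DDX\<nu>: "ddir w (ddir v X) z \<bullet> ?\<nu> = ddir w (ddir v f) z" if "z \<in> V" for v w z
  proof -
    have "ddir w (ddir v X) z \<bullet> ?\<nu> = ddir w (\<lambda>z. ddir v X z \<bullet> ?\<nu>) z"
      by (rule ddir_bounded_linear[OF bounded_linear_inner_left ddX'[OF that], symmetric])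
    also have "\<dots> = ddir w (ddir v f) z" by (rule ddir_cong[OF UV(4) that DX\<nu>])
    finally show ?thesis .
  qed
  \<comment> \<open>Orthogonality of the normal to the k-th coordinate tangent vector, which is
    \<open>d k\<close> plus \<open>pdir k f z\<close> times \<open>\<xi> p\<close>.\<close>
  have Nd: "N z \<bullet> d k = - (\<theta> z * pdir k f z)" if "z \<in> V" for z k
  proof -
    have "0 = (\<Sum>i\<in>UNIV. axis k 1 $ i * (N z \<bullet> d i)) + pdir k f z * \<theta> z"
      using perp'[OF that, of "axis k 1"] expand(2)[of "ddir (axis k 1) X z" "N z"]
      by (simp add: DXd DX\<nu> that \<theta>_def)
    also have "(\<Sum>i\<in>UNIV. axis k 1 $ i * (N z \<bullet> d i)) = N z \<bullet> d k"
      by (simp add: axis_def if_distrib[of "\<lambda>u. u * _"] cong: if_cong)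
    finally show ?thesis by (simp add: mult.commute)
  qed
  have norm: "\<theta> z * \<theta> z * (1 + (\<Sum>k\<in>UNIV. pdir k f z * pdir k f z)) = 1" if "z \<in> V" for z
    using unit'[OF that] expand(2)[of "N z" "N z"]
    by (simp add: Nd that algebra_simps sum_distrib_left \<theta>z)
  define G where "G = (\<lambda>z. P (g z))"
  have xG: "x (G z) = X z" and \<xi>G: "\<xi> (G z) = N z" for z
    by (simp_all add: G_def X_def N_def XP)
  have Xz: "X z = (\<Sum>i\<in>UNIV. (z $ i) *\<^sub>R d i) + f z *\<^sub>R ?\<nu>" if "z \<in> V" for z
    using expand(1)[of "X z"] by (simp add: Xd that fz)
  have u: "X z \<bullet> N z = \<theta> z * (f z - (\<Sum>k\<in>UNIV. z $ k * pdir k f z))" if "z \<in> V" for z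
    using expand(2)[of "X z" "N z"]
    by (simp add: Xd Nd that algebra_simps sum_negf sum_distrib_left fz \<theta>z)
  have curv: "mean_curvature A x \<xi> (G z) = (\<Sum>k\<in>UNIV. graph_shape f \<theta> k k z)"
    "sff_norm_sq A x \<xi> (G z) = (\<Sum>k\<in>UNIV. \<Sum>l\<in>UNIV. graph_shape f \<theta> k l z * graph_shape f \<theta> l k z)"
    if z: "z \<in> V" for z
  proof -
    have q: "G z \<in> fst c" using P gU z by (simp add: G_def)
    obtain e' where e': "orthonormal_frame x c (G z) e'" by (rule frame_at[OF c(1) q])
    \<comment> \<open>The chart frame \<open>e'\<close> expressed in graph coordinates.\<close>
    define w where "w i = inv (\<lambda>v. ddir v g z) (e' i)" for i
    have w: "ddir (w i) g z = e' i" for i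
      using surj_f_inv_f[OF bij_is_surj[OF bij[OF z]]] by (simp add: w_def)
    define \<delta> where "\<delta> i = ddir (w i) X z" for i
    have \<delta>: "differential c x (G z) (e' i) = \<delta> i" for i
      unfolding \<delta>_def chX[OF z] w G_def by (rule diff[OF gU[OF z]])
    have \<delta>N: "differential c \<xi> (G z) (e' i) = ddir (w i) N z" for i
      unfolding chN[OF z] w G_def by (rule diff[OF gU[OF z]])
    have \<delta>\<delta>: "\<delta> i \<bullet> \<delta> j = (if i = j then 1 else 0)" for i j
      using e' by (simp add: orthonormal_frame_def first_fundamental_form_def \<delta>)
    have \<delta>perp: "\<delta> i \<bullet> N z = 0" for i unfolding \<delta>_def by (rule perp'[OF z])
    define W :: "real ^ 'n ^ 'n" where "W = (\<chi> i k. w i $ k)"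
    define Fm :: "real ^ 'n ^ 'n" where "Fm = (\<chi> k l. pdir l (pdir k f) z)"
    have Wd: "d k \<bullet> \<delta> i = W $ i $ k" for i k
      using DXd[OF z, of "w i" k] by (simp add: W_def \<delta>_def inner_commute)
    have dN: "d k \<bullet> N z = - (\<theta> z * pdir k f z)" for k
      using Nd[OF z, of k] by (simp add: inner_commute)
    \<comment> \<open>The inner product of \<open>d k\<close> and \<open>d l\<close>, expanded in
      the orthonormal basis formed by \<open>\<delta>\<close> and the normal at
      \<open>z\<close>.\<close>
    have WW: "(\<Sum>i\<in>UNIV. W $ i $ k * W $ i $ l)
        = (if k = l then 1 else 0) - (\<theta> z * pdir k f z) * (\<theta> z * pdir l f z)" for k l
      using orthonormal_hyperplane_expand(2)[OF DIM \<delta>\<delta> \<delta>perp unit'[OF z], of "d k" "d l"]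
      by (simp add: Wd d dN)
    \<comment> \<open>Differentiating the orthogonality of \<open>ddir (w i) X\<close> and
      \<open>N\<close> moves the derivative from the normal to the tangent vector. Second
      derivatives of \<open>X\<close> have only a component along \<open>\<xi> p\<close>, namely
      those of \<open>f\<close>.\<close>
    have h: "second_fundamental_form x \<xi> c (G z) (e' i) (e' j)
        = \<theta> z * (\<Sum>k\<in>UNIV. \<Sum>l\<in>UNIV. W $ i $ k * W $ j $ l * Fm $ k $ l)" for i j
    proof -
      have "ddir (w j) (\<lambda>z. ddir (w i) X z \<bullet> N z) z = ddir (w j) (\<lambda>z. 0) z"
        by (rule ddir_cong[OF UV(4) z]) (rule perp')
      then have "\<delta> i \<bullet> ddir (w j) N z + ddir (w j) (ddir (w i) X) z \<bullet> N z = 0"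
        by (simp add: ddir_bilinear[OF bounded_bilinear_inner ddX'[OF z] dN'[OF z]] \<delta>_def)
      moreover have "ddir (w j) (ddir (w i) X) z \<bullet> N z = ddir (w j) (ddir (w i) f) z * \<theta> z"
        by (subst expand(2)) (simp add: DDXd DDX\<nu> z \<theta>_def)
      ultimately have "- (ddir (w j) N z \<bullet> \<delta> i) = \<theta> z * ddir (w j) (ddir (w i) f) z"
        unfolding mult.commute[of "\<theta> z"] inner_commute[of "ddir (w j) N z"] by linarith
      then have "second_fundamental_form x \<xi> c (G z) (e' i) (e' j)
          = \<theta> z * ddir (w j) (ddir (w i) f) z"
        by (simp add: second_fundamental_form_def \<delta> \<delta>N)
      also have "ddir (w j) (ddir (w i) f) z
          = (\<Sum>k\<in>UNIV. \<Sum>l\<in>UNIV. w i $ k * w j $ l * pdir l (pdir k f) z)"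
        by (rule ddir2_expand[OF UV(4) f z])
      finally show ?thesis by (simp add: W_def Fm_def)
    qed
    have Fsym: "Fm $ k $ l = Fm $ l $ k" for k l
      by (simp add: Fm_def) (rule ddir_swap[OF UV(4) f z])
    have B: "graph_shape f \<theta> k l z = \<theta> z * Fm $ k $ l
        - \<theta> z * (\<theta> z * \<theta> z) * (pdir k f z * (\<Sum>a\<in>UNIV. pdir a f z * Fm $ a $ l))" for k l
      by (simp add: graph_shape_def Fm_def)
    note sums = frame_sums_graph[OF WW Fsym h B]
    show "mean_curvature A x \<xi> (G z) = (\<Sum>k\<in>UNIV. graph_shape f \<theta> k k z)"
      using mean_curvature_eq[OF atlas immersion normal c(1) q e'] sums(1) by simp
    show "sff_norm_sq A x \<xi> (G z) = (\<Sum>k\<in>UNIV. \<Sum>l\<in>UNIV. graph_shape f \<theta> k l z * graph_shape f \<theta> l k z)"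
      using sff_norm_sq_eq[OF atlas immersion normal c(1) q e'] sums(2) by simp
  qed
  have G0: "G (F y0) = p" by (simp add: G_def gF y0)
  have \<theta>0: "\<theta> (F y0) = 1" using \<xi>G[of "F y0"] G0 \<nu> by (simp add: \<theta>_def)
  have f0: "pdir k f (F y0) = 0" for k
    using Nd[OF UV(5), of k] \<theta>0 \<xi>G[of "F y0"] G0 d\<nu>[of k] by (simp add: inner_commute)
  have GM: "G z \<in> topspace M" if "z \<in> V" for z
    using P(1) gU[OF that] sub by (auto simp: G_def)
  have xGz: "x (G z) = (\<Sum>i\<in>UNIV. (z $ i) *\<^sub>R d i) + f z *\<^sub>R ?\<nu>" if "z \<in> V" for z
    unfolding xG by (rule Xz[OF that])
  have uG: "x (G z) \<bullet> \<xi> (G z) = \<theta> z * (f z - (\<Sum>k\<in>UNIV. z $ k * pdir k f z))" if "z \<in> V" for z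
    unfolding xG \<xi>G by (rule u[OF that])
  show thesis
    by (rule that[where V = V and zp = "F y0" and G = G and f = f and \<theta> = \<theta> and d = d, OF UV(4,5) G0 GM d d\<nu> f \<theta> \<theta>0 f0 norm xGz uG curv])
qed

end

section \<open>The point farthest from the origin\<close>

text \<open>In graph coordinates |x|^2 is |z|^2 + f^2. At a critical point of \<open>f\<close> its
  gradient is \<open>2 *\<^sub>R p\<close>, which must vanish, and half its second derivative along
  \<open>v\<close> is the left-hand side of the second claim.\<close>

lemma graph_farthest_point:
  fixes f :: "real ^ 'n::finite \<Rightarrow> real"
  assumes V: "open V" "p \<in> V" and f: "smooth_on f V" and crit: "\<And>k. pdir k f p = 0"
    and max: "\<And>z. z \<in> V \<Longrightarrow>
      (\<Sum>k\<in>UNIV. z $ k * z $ k) + f z * f z \<le> (\<Sum>k\<in>UNIV. p $ k * p $ k) + f p * f p"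
  shows "p = 0"
    and "v \<bullet> v + f 0 * (\<Sum>i\<in>UNIV. \<Sum>j\<in>UNIV. v $ i * v $ j * pdir j (pdir i f) 0) \<le> 0"
proof -
  let ?q = "\<lambda>z::real^'n. \<Sum>k\<in>UNIV. z $ k * z $ k"
  let ?\<phi> = "\<lambda>z. ?q z + f z * f z"
  have coord: "smooth_on (\<lambda>z::real^'n. z $ k) V" for k
    by (rule smooth_on_linear[OF V(1) bounded_linear_vec_nth])
  have sq: "smooth_on ?q V" and sf: "smooth_on (\<lambda>z. f z * f z) V" and s\<phi>: "smooth_on ?\<phi> V"
    by (intro smooth_on_add smooth_on_sum smooth_on_mult V coord f)+
  have c1: "ddir v (\<lambda>z::real^'n. z $ k) z = v $ k" for v z k
  proof -
    have "ddir v (\<lambda>z::real^'n. z $ k) z = ddir v (\<lambda>z. z) z $ k"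
      by (rule ddir_bounded_linear[OF bounded_linear_vec_nth]) simp
    then show ?thesis by (simp add: ddir_def)
  qed
  then have c1': "ddir v (\<lambda>z::real^'n. z $ k) = (\<lambda>z. v $ k)" for v k by blast
  have fv: "ddir v f p = 0" for v
    using ddir_expand[OF smooth_on_differentiable[OF f V]] crit by simp
  have q1: "ddir v ?q p = (\<Sum>k\<in>UNIV. 2 * (p $ k * v $ k))" for v
    by (subst ddir_sum_on[OF V(1) _ V(2)])
      (auto intro!: smooth_on_mult V coord sum.cong simp: ddir_mult_on[OF V(1) coord coord V(2)] c1)
  have q2: "ddir v (ddir v ?q) p = (\<Sum>k\<in>UNIV. 2 * (v $ k * v $ k))" for v
    by (subst ddir2_sum_on[OF V(1) _ V(2)])
      (auto intro!: smooth_on_mult V coord sum.cong simp: ddir2_mult_on[OF V(1) coord coord V(2)] c1')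
  have \<phi>0: "ddir v ?\<phi> p = 0" for v
    by (rule ddir_local_max[OF V(1) s\<phi> V(2) max])
  have \<phi>1: "ddir v ?\<phi> p = (\<Sum>k\<in>UNIV. 2 * (p $ k * v $ k))" for v
    by (simp add: ddir_add_on[OF V(1) sq sf V(2)] q1 ddir_mult_on[OF V(1) f f V(2)] fv)
  \<comment> \<open>The derivative is tested in the direction \<open>p\<close> itself.\<close>
  have "(\<Sum>k\<in>UNIV. 2 * (p $ k * p $ k)) = 0" using \<phi>0[of p] unfolding \<phi>1 .
  then have "p \<bullet> p = 0" by (simp add: inner_vec_def flip: sum_distrib_left)
  then show p: "p = 0" by simp
  have "ddir v (ddir v ?\<phi>) p \<le> 0"
    by (rule ddir2_local_max[OF V(1) s\<phi> V(2) max])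
  moreover have "ddir v (ddir v ?\<phi>) p = (\<Sum>k\<in>UNIV. 2 * (v $ k * v $ k)) + 2 * (f p * ddir v (ddir v f) p)"
    by (simp add: ddir2_add_on[OF V(1) sq sf V(2)] q2 ddir2_mult_on[OF V(1) f f V(2)] fv)
  ultimately have le: "v \<bullet> v + f p * ddir v (ddir v f) p \<le> 0"
    by (simp add: inner_vec_def flip: sum_distrib_left)
  have e: "ddir v (ddir v f) p = (\<Sum>i\<in>UNIV. \<Sum>j\<in>UNIV. v $ i * v $ j * pdir j (pdir i f) p)"
    by (rule ddir2_expand[OF V(1) f V(2)])
  show "v \<bullet> v + f 0 * (\<Sum>i\<in>UNIV. \<Sum>j\<in>UNIV. v $ i * v $ j * pdir j (pdir i f) 0) \<le> 0"
    using le[unfolded e, unfolded p] .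
qed

section \<open>From the farthest point to the whole hypersurface\<close>

context immersed_hypersurface
begin

text \<open>Smoothness speaks of local representatives only, so continuity on \<open>M\<close> is
  pasted together from the charts.\<close>

lemma continuous_map_x: "continuous_map M euclidean x"
proof (rule pasting_lemma[where I = A and T = fst and f = "\<lambda>_. x"])
  fix c assume c: "c \<in> A"
  have chart: "is_chart M c" using atlas c by (auto simp: smooth_atlas_def)
  then show "openin M (fst c)" by (auto simp: is_chart_def case_prod_beta)
  have "continuous_map (subtopology M (fst c)) (top_of_set (snd c ` fst c)) (snd c)"
    using chart by (auto simp: is_chart_def case_prod_beta homeomorphic_imp_continuous_map)
  moreover have "continuous_map (top_of_set (snd c ` fst c)) euclidean (local_rep c x)"
    using smooth_x c smooth_on_continuous by (auto simp: smooth_map_def)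
  ultimately have "continuous_map (subtopology M (fst c)) euclidean (local_rep c x \<circ> snd c)"
    by (rule continuous_map_compose)
  then show "continuous_map (subtopology M (fst c)) euclidean x"
    by (rule continuous_map_eq) (use chart_inj[OF chart] in \<open>auto simp: local_rep_def\<close>)
qed (use chart_at in \<open>auto, metis\<close>)

lemma compact_image:
  assumes "compact_space M" shows "compact (x ` topspace M)"
  using image_compactin[OF _ continuous_map_x] assms by (simp add: compact_space_def)

text \<open>At a point farthest from the origin the Simons inequality says that \<open>- u\<^sub>0 h \<ge> I\<close> satisfies
  the assumption of \<open>symmetric_rigidity\<close>, so that the point is umbilic.\<close>

lemma curvature_at_farthest_point:
  assumes exp: "self_expander lam M A x \<xi>"
    and const: "\<And>q. q \<in> topspace M \<Longrightarrow> sff_norm_sq A x \<xi> q = s"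
    and p: "p \<in> topspace M" and max: "\<And>q. q \<in> topspace M \<Longrightarrow> norm (x q) \<le> norm (x p)"
  obtains u0 where "u0 \<noteq> 0" "\<bar>u0\<bar> = norm (x p)" "- u0 * (lam + u0 / 2) = real CARD('n)"
    "u0\<^sup>2 * s = real CARD('n)"
proof -
  obtain V :: "(real ^ 'n) set" and zp G f \<theta> and d :: "'n \<Rightarrow> real ^ 'm"
    where V: "open V" "zp \<in> V" and G: "G zp = p" "\<And>z. z \<in> V \<Longrightarrow> G z \<in> topspace M"
    and d: "\<And>i j. d i \<bullet> d j = (if i = j then 1 else 0)" "\<And>i. d i \<bullet> \<xi> p = 0"
    and f: "smooth_on f V" "smooth_on \<theta> V" "\<theta> zp = 1" "\<And>k. pdir k f zp = 0"
    and norm: "\<And>z. z \<in> V \<Longrightarrow> \<theta> z * \<theta> z * (1 + (\<Sum>k\<in>UNIV. pdir k f z * pdir k f z)) = 1"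
    and xG: "\<And>z. z \<in> V \<Longrightarrow> x (G z) = (\<Sum>i\<in>UNIV. (z $ i) *\<^sub>R d i) + f z *\<^sub>R \<xi> p"
    and uG: "\<And>z. z \<in> V \<Longrightarrow> x (G z) \<bullet> \<xi> (G z) = \<theta> z * (f z - (\<Sum>k\<in>UNIV. z $ k * pdir k f z))"
    and HG: "\<And>z. z \<in> V \<Longrightarrow> mean_curvature A x \<xi> (G z) = (\<Sum>k\<in>UNIV. graph_shape f \<theta> k k z)"
    and SG: "\<And>z. z \<in> V \<Longrightarrow> sff_norm_sq A x \<xi> (G z)
      = (\<Sum>k\<in>UNIV. \<Sum>l\<in>UNIV. graph_shape f \<theta> k l z * graph_shape f \<theta> l k z)"
    by (rule graph_chart[OF p]) (rule that; assumption)
  have \<nu>: "\<xi> p \<bullet> \<xi> p = 1" using norm_\<xi>[OF p] by (simp add: norm_eq_1)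
  have DIM: "DIM(real ^ 'm) = CARD('n) + 1" using dim by simp
  have \<nu>d: "\<xi> p \<bullet> d i = 0" for i using d(2)[of i] by (simp add: inner_commute)
  have inner: "x (G z) \<bullet> d i = z $ i" "x (G z) \<bullet> \<xi> p = f z" if "z \<in> V" for z i
    by (simp_all add: xG[OF that] inner_add_left inner_sum_left d \<nu> \<nu>d if_distrib cong: if_cong)
  have sq: "x (G z) \<bullet> x (G z) = (\<Sum>k\<in>UNIV. z $ k * z $ k) + f z * f z" if "z \<in> V" for z
    using orthonormal_hyperplane_expand(2)[OF DIM d \<nu>, of "x (G z)" "x (G z)"] inner[OF that] by simp
  have "(\<Sum>k\<in>UNIV. z $ k * z $ k) + f z * f z \<le> (\<Sum>k\<in>UNIV. zp $ k * zp $ k) + f zp * f zp"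
    if "z \<in> V" for z
  proof -
    have "norm (x (G z)) \<le> norm (x (G zp))" using max G that by simp
    then show ?thesis using sq that V by (simp add: norm_le)
  qed
  note far = graph_farthest_point[OF V f(1,4) this]
  have zp: "zp = 0" by (rule far)
  note V = V[unfolded zp] and f = f[unfolded zp] and G = G[unfolded zp]
  define u0 where "u0 = f 0"
  define h where "h k l = pdir l (pdir k f) 0" for k l
  define K where "K i j = - u0 * h i j" for i j
  have ge: "v \<bullet> v \<le> (\<Sum>i\<in>UNIV. \<Sum>j\<in>UNIV. v $ i * v $ j * K i j)" for v
    using far(2)[of v] by (simp add: K_def u0_def h_def sum_distrib_left sum_negf mult_ac)
  have "u0 \<noteq> 0"
  proof
    assume "u0 = 0"
    \<comment> \<open>Then \<open>K\<close> would vanish, contradicting \<open>ge\<close> at any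
      unit vector; the index \<open>undefined\<close> is an arbitrary one.\<close>
    then show False using ge[of "axis undefined 1"] by (simp add: K_def inner_axis_axis)
  qed
  have u0: "\<bar>u0\<bar> = norm (x p)"
    using sq[OF V(2)] by (simp add: G u0_def norm_eq_sqrt_inner)
  have mean: "(\<Sum>k\<in>UNIV. graph_shape f \<theta> k k z)
      = lam + 1 / 2 * (\<theta> z * (f z - (\<Sum>k\<in>UNIV. z $ k * pdir k f z)))" if "z \<in> V" for z
    using exp G(2)[OF that] uG[OF that] HG[OF that] unfolding self_expander_def
    by (auto simp: algebra_simps)
  have sff: "(\<Sum>k\<in>UNIV. \<Sum>l\<in>UNIV. graph_shape f \<theta> k l z * graph_shape f \<theta> l k z) = s" if "z \<in> V" for z
    using const[OF G(2)[OF that]] SG[OF that] by simp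
  note simons = graph_simons_inequality[OF V f norm graph_shape_def mean sff, folded h_def u0_def]
  let ?k1 = "\<Sum>i\<in>UNIV. h i i" and ?S = "\<Sum>i\<in>UNIV. \<Sum>j\<in>UNIV. h i j * h i j"
    and ?T = "\<Sum>i\<in>UNIV. \<Sum>j\<in>UNIV. h i j * (\<Sum>a\<in>UNIV. h i a * h a j)"
  have k1: "?k1 = lam + u0 / 2" by (rule simons(2))
  have K1: "(\<Sum>i\<in>UNIV. K i i) = - u0 * ?k1"
    by (simp add: K_def sum_distrib_left)
  have K2: "(\<Sum>i\<in>UNIV. \<Sum>j\<in>UNIV. K i j * K i j) = u0\<^sup>2 * ?S"
    by (simp add: K_def sum_distrib_left power2_eq_square mult_ac)
  have K3: "(\<Sum>i\<in>UNIV. \<Sum>j\<in>UNIV. K i j * (\<Sum>a\<in>UNIV. K i a * K a j)) = - (u0 ^ 3) * ?T"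
    by (simp add: K_def sum_distrib_left power3_eq_cube mult_ac sum_negf)
  have K: "K i j = (if i = j then 1 else 0)" for i j
  proof (rule symmetric_rigidity[OF _ _ ge])
    show "K i j = K j i" for i j
      using ddir_swap[OF V(1) f(1) V(2)] by (metis K_def h_def)
    \<comment> \<open>With this constant the first factor on the left of the rigidity hypothesis
      collapses to \<open>- u0 * lam\<close>, so the hypothesis is the Simons inequality multiplied
      by the fourth power of \<open>u0\<close>.\<close>
    show "u0\<^sup>2 / 2 > 0" using \<open>u0 \<noteq> 0\<close> by simp
    have "u0\<^sup>2 * u0\<^sup>2 * (lam * ?T) \<le> u0\<^sup>2 * u0\<^sup>2 * (?S\<^sup>2 + ?S / 2)"
      by (intro mult_left_mono[OF simons(1)] mult_nonneg_nonneg zero_le_power2)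
    then show "((\<Sum>i\<in>UNIV. K i i) + u0\<^sup>2 / 2) * (\<Sum>i\<in>UNIV. \<Sum>j\<in>UNIV. K i j * (\<Sum>a\<in>UNIV. K i a * K a j))
      \<le> (\<Sum>i\<in>UNIV. \<Sum>j\<in>UNIV. K i j * K i j)\<^sup>2 + u0\<^sup>2 / 2 * (\<Sum>i\<in>UNIV. \<Sum>j\<in>UNIV. K i j * K i j)"
      unfolding K1 K2 K3 k1
      by (simp add: algebra_simps power2_eq_square power3_eq_cube)
  qed
  \<comment> \<open>As \<open>K\<close> is the identity, its trace and its squared norm both equal
    n.\<close>
  show thesis
  proof (rule that[OF \<open>u0 \<noteq> 0\<close> u0])
    show "- u0 * (lam + u0 / 2) = real CARD('n)"
      using K1 by (simp add: K flip: simons(2))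
    show "u0\<^sup>2 * s = real CARD('n)"
      using K2 by (simp add: K if_distrib simons(3) cong: if_cong)
  qed
qed

text \<open>The bound H^2 \<le> n S and the value of S found at the farthest point give |u0 H| \<le>
  n at every point. Through the self-expander equation this says that u0 \<langle>x, \<xi>\<rangle>
  is at least \<open>u0\<^sup>2\<close>, while maximality gives the opposite bound.\<close>

lemma norm_x_constant:
  assumes exp: "self_expander lam M A x \<xi>"
    and const: "\<And>q. q \<in> topspace M \<Longrightarrow> sff_norm_sq A x \<xi> q = s"
    and compact: "compact_space M" and ne: "topspace M \<noteq> {}"
  obtains u0 where "u0 \<noteq> 0" "\<And>q. q \<in> topspace M \<Longrightarrow> norm (x q) = \<bar>u0\<bar>"
    "\<And>q. q \<in> topspace M \<Longrightarrow> x q \<bullet> \<xi> q = u0"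
proof -
  obtain y where y: "y \<in> x ` topspace M" "\<And>w. w \<in> x ` topspace M \<Longrightarrow> norm w \<le> norm y"
    using continuous_attains_sup[OF compact_image[OF compact], of norm] ne
    by (auto intro: continuous_intros)
  then obtain p where p: "p \<in> topspace M" "y = x p" by blast
  have max: "norm (x q) \<le> norm (x p)" if "q \<in> topspace M" for q using y(2)[of "x q"] p(2) that by simp
  obtain u0 where u0: "u0 \<noteq> 0" "\<bar>u0\<bar> = norm (x p)"
    and H0: "- u0 * (lam + u0 / 2) = real CARD('n)" and S0: "u0\<^sup>2 * s = real CARD('n)"
    by (rule curvature_at_farthest_point[OF exp const p(1) max]) (assumption | rule that; assumption)+
  have main: "norm (x q) = \<bar>u0\<bar> \<and> x q \<bullet> \<xi> q = u0" if q: "q \<in> topspace M" for q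
  proof -
    define u where "u = x q \<bullet> \<xi> q"
    define H where "H = mean_curvature A x \<xi> q"
    have H: "H = lam + u / 2" using exp q by (auto simp: self_expander_def H_def u_def)
    have ul: "\<bar>u\<bar> \<le> norm (x q)"
      using Cauchy_Schwarz_ineq2[of "x q" "\<xi> q"] norm_\<xi>[OF q] by (simp add: u_def)
    then have "\<bar>u\<bar> \<le> \<bar>u0\<bar>" using max[OF q] u0 by linarith
    have "(u0 * H)\<^sup>2 \<le> u0\<^sup>2 * (real CARD('n) * s)"
      unfolding power_mult_distrib
      using mean_curvature_sq_le[OF q] const[OF q] by (simp add: H_def mult_left_mono)
    also have "\<dots> = (real CARD('n))\<^sup>2" using S0 by (simp add: power2_eq_square algebra_simps)
    finally have "\<bar>u0 * H\<bar> \<le> real CARD('n)" by (simp add: abs_le_square_iff[symmetric])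
    then have "- (u0 * H) \<le> - u0 * (lam + u0 / 2)" using H0 by linarith
    then have "u0 * u0 \<le> u0 * u" by (simp add: H algebra_simps)
    then have "0 \<le> u0 * (u - u0)" by (simp add: algebra_simps)
    \<comment> \<open>For either sign of \<open>u0\<close> this pushes \<open>u\<close> at least as
      far from 0 as \<open>u0\<close>, and the absolute bound leaves equality.\<close>
    then have "u = u0" using \<open>\<bar>u\<bar> \<le> \<bar>u0\<bar>\<close> u0(1) by (auto simp: zero_le_mult_iff)
    then show ?thesis using ul max[OF q] u0 by (auto simp: u_def)
  qed
  show thesis using that[OF u0(1)] main by blast
qed

text \<open>Near \<open>x q\<close> a point of the sphere is determined by its projection to the tangent hyperplane,
  and all nearby projections are attained in the graph chart.\<close>

lemma image_open_in_sphere: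
  assumes q: "q \<in> topspace M" and u0: "u0 \<noteq> 0" "x q \<bullet> \<xi> q = u0"
    and norm: "\<And>p. p \<in> topspace M \<Longrightarrow> norm (x p) = r"
  obtains W where "open W" "x q \<in> W" "sphere 0 r \<inter> W \<subseteq> x ` topspace M"
proof -
  obtain V :: "(real ^ 'n) set" and zq G f \<theta> and d :: "'n \<Rightarrow> real ^ 'm"
    where V: "open V" "zq \<in> V" and G: "G zq = q" "\<And>z. z \<in> V \<Longrightarrow> G z \<in> topspace M"
    and d: "\<And>i j. d i \<bullet> d j = (if i = j then 1 else 0)" "\<And>i. d i \<bullet> \<xi> q = 0"
    and f: "smooth_on f V"
    and xG: "\<And>z. z \<in> V \<Longrightarrow> x (G z) = (\<Sum>i\<in>UNIV. (z $ i) *\<^sub>R d i) + f z *\<^sub>R \<xi> q"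
    by (rule graph_chart[OF q]) (rule that; assumption)
  have \<nu>: "\<xi> q \<bullet> \<xi> q = 1" using norm_\<xi>[OF q] by (simp add: norm_eq_1)
  have DIM: "DIM(real ^ 'm) = CARD('n) + 1" using dim by simp
  note expand = orthonormal_hyperplane_expand[OF DIM d \<nu>]
  have \<nu>d: "\<xi> q \<bullet> d i = 0" for i using d(2)[of i] by (simp add: inner_commute)
  have inner: "x (G z) \<bullet> d i = z $ i" "x (G z) \<bullet> \<xi> q = f z" if "z \<in> V" for z i
    by (simp_all add: xG[OF that] inner_add_left inner_sum_left d \<nu> \<nu>d if_distrib cong: if_cong)
  define L :: "real ^ 'm \<Rightarrow> real ^ 'n" where "L y = (\<chi> i. y \<bullet> d i)" for y
  \<comment> \<open>Two points of the sphere may share a projection and differ in the sign of the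
    component along \<open>\<xi> q\<close>. The condition selects the hemisphere of
    \<open>x q\<close>, where that component has the sign of \<open>u0\<close>.\<close>
  define V' where "V' = {z \<in> V. f z * u0 > 0}"
  have "open ((\<lambda>z. f z * u0) -` {0<..} \<inter> V)"
    using continuous_open_preimage[OF continuous_on_mult_right[OF smooth_on_continuous[OF f]] V(1) open_greaterThan]
    by (simp add: Int_commute)
  then have oV': "open V'" by (simp add: V'_def Collect_conj_eq vimage_def Int_commute)
  have contL: "continuous_on UNIV L" unfolding L_def by (intro continuous_intros)
  define W where "W = L -` V' \<inter> {y. (y \<bullet> \<xi> q) * u0 > 0}"
  show thesis
  proof
    show "open W" unfolding W_def
      by (intro open_Int open_vimage oV' contL open_Collect_less continuous_intros)
    have "L (x q) = zq" using inner(1)[OF V(2)] by (simp add: L_def G vec_eq_iff)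
    moreover have "f zq = u0" using inner(2)[OF V(2)] u0 by (simp add: G)
    ultimately show "x q \<in> W"
      using V u0 by (auto simp: W_def V'_def zero_less_mult_iff linorder_neq_iff)
    show "sphere 0 r \<inter> W \<subseteq> x ` topspace M"
    proof
      fix y assume y: "y \<in> sphere 0 r \<inter> W"
      define z where "z = L y"
      have z: "z \<in> V" "f z * u0 > 0" and yu: "(y \<bullet> \<xi> q) * u0 > 0"
        using y by (auto simp: z_def W_def V'_def)
      have yz: "y \<bullet> d i = z $ i" for i by (simp add: z_def L_def)
      have "y \<bullet> y = x (G z) \<bullet> x (G z)"
        using y norm[OF G(2)[OF z(1)]] by (simp add: dot_square_norm)
      \<comment> \<open>Equal norms and equal projections leave equal squares of the normal
        components.\<close>
      then have "(y \<bullet> \<xi> q)\<^sup>2 = (f z)\<^sup>2"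
        using expand(2)[of y y] expand(2)[of "x (G z)" "x (G z)"] inner[OF z(1)] yz
        by (simp add: power2_eq_square)
      then have "y \<bullet> \<xi> q = f z"
        using z(2) yu unfolding power2_eq_iff by (auto simp: zero_less_mult_iff)
      then have "y = x (G z)" using expand(1)[of y] xG[OF z(1)] yz by simp
      then show "y \<in> x ` topspace M" using G(2)[OF z(1)] by blast
    qed
  qed
qed

end

theorem theorem1p1:
  fixes M :: "'a topology" and A :: "('a, 'n::finite) chart set"
    and x \<xi> :: "'a \<Rightarrow> real ^ 'm::finite" and lam :: real
  assumes "CARD('m) = CARD('n) + 1"
    and "closed_connected_manifold M A"
    and "smooth_immersion A x"
    and "unit_normal_field A x \<xi>"
    and "self_expander lam M A x \<xi>"
    and "\<exists>s. \<forall>p\<in>topspace M. sff_norm_sq A x \<xi> p = s"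
  shows "\<exists>r>0. x ` topspace M = {y. norm y = r}"
proof -
  have M: "compact_space M" "topspace M \<noteq> {}"
    using assms(2) by (auto simp: closed_connected_manifold_def)
  interpret immersed_hypersurface M A x \<xi>
    using assms(1-4) by unfold_locales (auto simp: closed_connected_manifold_def)
  obtain s where s: "\<And>p. p \<in> topspace M \<Longrightarrow> sff_norm_sq A x \<xi> p = s" using assms(6) by blast
  obtain u0 where u0: "u0 \<noteq> 0" and norm: "\<And>q. q \<in> topspace M \<Longrightarrow> norm (x q) = \<bar>u0\<bar>"
    and u: "\<And>q. q \<in> topspace M \<Longrightarrow> x q \<bullet> \<xi> q = u0"
    by (rule norm_x_constant[OF assms(5) s M]) (assumption | rule that; assumption)+
  let ?S = "sphere (0 :: real ^ 'm) \<bar>u0\<bar>" and ?K = "x ` topspace M"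
  have sub: "?K \<subseteq> ?S" using norm by auto
  have "\<exists>T. openin (top_of_set ?S) T \<and> y \<in> T \<and> T \<subseteq> ?K" if y: "y \<in> ?K" for y
  proof -
    obtain q where q: "q \<in> topspace M" "y = x q" using y by blast
    obtain W where "open W" "x q \<in> W" "?S \<inter> W \<subseteq> ?K"
      by (rule image_open_in_sphere[OF q(1) u0 u[OF q(1)] norm]) (assumption | rule that; assumption)+
    then show ?thesis using q sub by (intro exI[of _ "?S \<inter> W"]) (auto simp: openin_open)
  qed
  then have "openin (top_of_set ?S) ?K" using openin_subopen by blast
  moreover have "closedin (top_of_set ?S) ?K"
    using compact_image[OF M(1)] sub by (simp add: closed_subset compact_imp_closed)
  \<comment> \<open>The ambient dimension is at least 2 because a finite type such as
    \<open>'n\<close> is nonempty.\<close>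
  moreover have "connected ?S"
    by (rule connected_sphere) (simp add: assms(1) Suc_le_eq)
  ultimately have "?K = ?S" using M(2) unfolding connected_clopen by blast
  then show ?thesis using u0 by (intro exI[of _ "\<bar>u0\<bar>"]) auto
qed

end
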